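(* Let $\Phi,\Psi$ be covariants of binary $d$-ics of degree-orders $(m,n)$ and $(m',n')$ (with $m,m'\ge1$), with evectants $\mathcal A_\bullet=\{\mathcal A_i\}_{0\le i\le\min(d,n)}$ and $\mathcal B_\bullet=\{\mathcal B_i\}_{0\le i\le\min(d,n')}$ respectively. Let $0\le r\le\min(n,n')$, let $\Theta=(\Phi,\Psi)_r$ (a covariant of degree-order $(m+m',n+n'-2r)$), and let $\mathcal C_\bullet$ be the evectants of $\Theta$. Then for $0\le s\le\min(d,n+n'-2r)$, $$\mathcal C_s=\sum_{i=0}^{\min(d,n)}\xi_i\,(\mathcal A_i,\Psi)_{r-i+s}+\sum_{i=0}^{\min(d,n')}\eta_i\,(\mathcal B_i,\Phi)_{r-i+s},$$ where $$\xi_i=\kappa\,m\sum_k\lambda(i,k;n,n')\;\mu(d-i+k,\,n+n'-2r-i+k;\,s,\,i-k)\;\nu(d-i,\,n-i-r+k,\,k,\,n'-r;\,s-i+k),$$ $$\eta_i=(-1)^r\kappa\,m'\sum_k\lambda(i,k;n',n)\;\mu(d-i+k,\,n+n'-2r-i+k;\,s,\,i-k)\;\nu(d-i,\,n'-i-r+k,\,k,\,n-r;\,s-i+k),$$ the sums over $k$ being respectively over $$\max(0,r-n+i,i-s)\le k\le\min(i,r)\quad\text{and}\quad\max(0,r-n'+i,i-s)\le k\le\min(i,r)$$ (an empty sum is $0$, and the corresponding term is then $0$). Here $$\kappa=\frac{(n-r)!\,(n'-r)!\,(d+n+n'-2r-2s+1)!}{n!\,n'!\,s!\,(d+n+n'-2r-s+1)!\,(m+m')},$$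 $$\lambda(i,k;n,n')=(-1)^k\frac{r!}{k!\,(r-k)!}\,\frac{i!}{(i-k)!}\,\frac{(n-i)!}{(n-i-r+k)!}\,\frac{n'!}{(n'-r)!},$$ $$\mu(p,q;\ell,i)=\frac{\ell!}{(\ell-i)!}\,\frac{(p+q-\ell+2i+1)!}{(p+q-\ell+i+1)!},$$ $$\nu(p_1,q_1,p_2,q_2;u)=\sum_t(-1)^{u-t}\frac{u!}{t!\,(u-t)!}\,\frac{p_1!}{(p_1-t)!}\,\frac{q_1!}{(q_1-u+t)!}\,\frac{p_2!}{(p_2-u+t)!}\,\frac{q_2!}{(q_2-t)!},$$ the last sum being over $\max(0,u-\min(q_1,p_2))\le t\le\min(p_1,q_2,u)$ and understood to be zero if this range is empty.
   Context: The base field is $\mathbf C$; $\mathbf x=(x_1,x_2)$, $\mathbf y=(y_1,y_2)$, $(\mathbf x\,\mathbf y)=x_1y_2-x_2y_1$. For binary forms $A,B$ in $\mathbf x$ of orders (homogeneous degrees) $m,n$ the $r$-th transvectant is $$(A,B)_r=\frac{(m-r)!\,(n-r)!}{m!\,n!}\sum_{i=0}^r(-1)^i\binom ri\frac{\partial^rA}{\partial x_1^{r-i}\partial x_2^i}\,\frac{\partial^rB}{\partial x_1^i\partial x_2^{r-i}},$$ and $(A,B)_r=0$ if $r>\min(m,n)$. $\mathbb F=\sum_{i=0}^d\binom di a_ix_1^{d-i}x_2^i$ is the generic binary $d$-ic. A covariant of binary $d$-ics of degree-order $(m,n)$ is an $SL_2(\mathbf C)$-equivariant form of order $n$ in $\mathbf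 x$ whose coefficients are homogeneous of degree $m$ in $a_0,\dots,a_d$. Evectants: let $\mathcal E(\mathbf x)=\sum_{i=0}^d x_1^i(-x_2)^{d-i}\frac{\partial}{\partial a_i}$. For a covariant $\Phi$ of degree-order $(m,n)$, $m\ge1$, the form $\Gamma=\frac1m\,[\mathcal E(\mathbf x)\circ\Phi(\mathbf y)]$ is bihomogeneous of orders $d,n$ in $\mathbf x,\mathbf y$, and it has a unique expansion (Gordan series) $$\Gamma=\sum_{i=0}^{\min(d,n)}(\mathbf x\,\mathbf y)^i\,\widetilde{\mathcal A}_i(\mathbf x,\mathbf y),\qquad \widetilde{\mathcal A}_i=\frac{(d-i)!}{(d+n-2i)!}\Big(y_1\frac{\partial}{\partial x_1}+y_2\frac{\partial}{\partial x_2}\Big)^{n-i}\mathcal A_i(\mathbf x),$$ where each $\mathcal A_i$ is a form of order $d+n-2i$ in $\mathbf x$ ($\widetilde{\mathcal A}_i$ is its polarization of orders $d-i,n-i$). The $\mathcal A_i$ are covariants of degree-order $(m-1,d+n-2i)$, called the evectants of $\Phi$. *)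

theory Defs
  imports "HOL-Analysis.Analysis" "HOL-Library.Poly_Mapping"
begin

datatype var = X1 | X2 | Y1 | Y2 | Coef nat

text \<open>
  The ring \<open>\<complex>[x\<^sub>1, x\<^sub>2, y\<^sub>1, y\<^sub>2, a\<^sub>0, a\<^sub>1, \<dots>]\<close>: a polynomial is the finitely supported map sending a
  monomial (itself a finitely supported exponent map) to its coefficient; \<open>Coef i\<close> is \<open>a\<^sub>i\<close>.
\<close>

type_synonym mpol = "(var \<Rightarrow>\<^sub>0 nat) \<Rightarrow>\<^sub>0 complex"

definition Const :: "complex \<Rightarrow> mpol" where
  "Const c = Poly_Mapping.single 0 c"

definition Var :: "var \<Rightarrow> mpol" where
  "Var v = Poly_Mapping.single (Poly_Mapping.single v 1) 1"

text \<open>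
  The partial derivative \<open>\<partial>/\<partial>v\<close>. The exponent subtraction is truncated, but monomials not
  containing \<open>v\<close> have coefficient \<open>0\<close>.
\<close>

definition pdiff :: "var \<Rightarrow> mpol \<Rightarrow> mpol" where
  "pdiff v p = (\<Sum>t\<in>Poly_Mapping.keys p.
     Poly_Mapping.single (t - Poly_Mapping.single v 1)
       (of_nat (Poly_Mapping.lookup t v) * Poly_Mapping.lookup p t))"

definition subst :: "(complex \<Rightarrow> 'b) \<Rightarrow> (var \<Rightarrow> 'b) \<Rightarrow> mpol \<Rightarrow> 'b::comm_semiring_1" where
  "subst h \<sigma> p = (\<Sum>t\<in>Poly_Mapping.keys p.
     h (Poly_Mapping.lookup p t) * (\<Prod>v\<in>Poly_Mapping.keys t. \<sigma> v ^ Poly_Mapping.lookup t v))"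

text \<open>\<open>\<Phi>(\<^bold>x) \<mapsto> \<Phi>(\<^bold>y)\<close>\<close>

fun y_of_x :: "var \<Rightarrow> var" where
  "y_of_x X1 = Y1"
| "y_of_x X2 = Y2"
| "y_of_x v = v"

definition in_y :: "mpol \<Rightarrow> mpol" where
  "in_y p = subst Const (\<lambda>v. Var (y_of_x v)) p"

text \<open>Forms of order \<open>n\<close> in \<open>\<^bold>x\<close> with coefficients in \<open>\<complex>[a\<^sub>0, \<dots>, a\<^sub>d]\<close>.\<close>

definition is_form :: "nat \<Rightarrow> nat \<Rightarrow> mpol \<Rightarrow> bool" where
  "is_form d n p \<longleftrightarrow> (\<forall>t\<in>Poly_Mapping.keys p.
     Poly_Mapping.keys t \<subseteq> {X1, X2} \<union> Coef ` {..d} \<and>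
     Poly_Mapping.lookup t X1 + Poly_Mapping.lookup t X2 = n)"

definition homogeneous_in_coefs :: "nat \<Rightarrow> nat \<Rightarrow> mpol \<Rightarrow> bool" where
  "homogeneous_in_coefs d m p \<longleftrightarrow>
     (\<forall>t\<in>Poly_Mapping.keys p. (\<Sum>i\<le>d. Poly_Mapping.lookup t (Coef i)) = m)"

definition generic_form :: "nat \<Rightarrow> mpol" where
  "generic_form d =
     (\<Sum>i\<le>d. Const (of_nat (d choose i)) * Var (Coef i) * Var X1 ^ (d - i) * Var X2 ^ i)"

fun point :: "(nat \<Rightarrow> complex) \<Rightarrow> complex^2 \<Rightarrow> var \<Rightarrow> complex" where
  "point a x X1 = x $ 1"
| "point a x X2 = x $ 2"
| "point a x (Coef i) = a i"
| "point a x Y1 = 0"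
| "point a x Y2 = 0"

definition form_at :: "mpol \<Rightarrow> (nat \<Rightarrow> complex) \<Rightarrow> complex^2 \<Rightarrow> complex" where
  "form_at p a x = subst (\<lambda>c. c) (point a x) p"

text \<open>
  With \<open>(g\<cdot>F)(\<^bold>x) = F(g\<^sup>-\<^sup>1\<^bold>x)\<close>, equivariance of the map \<open>F \<mapsto> \<Phi>\<^sub>F\<close> is \<open>\<Phi>\<^bsub>g\<cdot>F\<^esub> = g\<cdot>\<Phi>\<^sub>F\<close>; below \<open>g\<close> is replaced
  by its inverse, and \<open>b\<close> is the coefficient vector of the transform of the form with coefficient
  vector \<open>a\<close>.
\<close>

definition SL2_equivariant :: "nat \<Rightarrow> mpol \<Rightarrow> bool" where
  "SL2_equivariant d \<Phi> \<longleftrightarrow> (\<forall>(g :: complex^2^2) a b. det g = 1 \<longrightarrow>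
     (\<forall>x. form_at (generic_form d) b x = form_at (generic_form d) a (g *v x)) \<longrightarrow>
     (\<forall>x. form_at \<Phi> b x = form_at \<Phi> a (g *v x)))"

definition is_covariant :: "nat \<Rightarrow> nat \<Rightarrow> nat \<Rightarrow> mpol \<Rightarrow> bool" where
  "is_covariant d m n \<Phi> \<longleftrightarrow>
     is_form d n \<Phi> \<and> homogeneous_in_coefs d m \<Phi> \<and> SL2_equivariant d \<Phi>"

text \<open>\<open>transvectant m n r A B\<close> is \<open>(A, B)\<^sub>r\<close> for forms \<open>A\<close>, \<open>B\<close> of orders \<open>m\<close>, \<open>n\<close>.\<close>

definition transvectant :: "nat \<Rightarrow> nat \<Rightarrow> nat \<Rightarrow> mpol \<Rightarrow> mpol \<Rightarrow> mpol" where
  "transvectant m n r A B =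
     (if r > min m n then 0
      else Const (fact (m - r) * fact (n - r) / (fact m * fact n)) *
        (\<Sum>i\<le>r. Const ((- 1) ^ i * of_nat (r choose i)) *
           (pdiff X1 ^^ (r - i)) ((pdiff X2 ^^ i) A) *
           (pdiff X1 ^^ i) ((pdiff X2 ^^ (r - i)) B)))"

text \<open>\<open>\<Gamma> = [\<E>(\<^bold>x) \<circ> \<Phi>(\<^bold>y)] / m\<close>\<close>

definition Gamma_form :: "nat \<Rightarrow> nat \<Rightarrow> mpol \<Rightarrow> mpol" where
  "Gamma_form d m \<Phi> =
     Const (1 / of_nat m) *
     (\<Sum>i\<le>d. Var X1 ^ i * (- Var X2) ^ (d - i) * pdiff (Coef i) (in_y \<Phi>))"

definition bracket_xy :: mpol where
  "bracket_xy = Var X1 * Var Y2 - Var X2 * Var Y1"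

definition polarization :: "nat \<Rightarrow> nat \<Rightarrow> nat \<Rightarrow> mpol \<Rightarrow> mpol" where
  "polarization d n i A =
     Const (fact (d - i) / fact (d + n - 2 * i)) *
     ((\<lambda>p. Var Y1 * pdiff X1 p + Var Y2 * pdiff X2 p) ^^ (n - i)) A"

text \<open>
  The evectants of \<open>\<Phi>\<close> (of degree-order \<open>(m, n)\<close>) are the family \<open>\<A>\<^sub>i\<close>, \<open>0 \<le> i \<le> min(d, n)\<close>, of forms
  occurring in the Gordan series of \<open>\<Gamma>\<close>; values of \<open>\<A>\<close> outside this range are irrelevant.
\<close>

definition are_evectants :: "nat \<Rightarrow> nat \<Rightarrow> nat \<Rightarrow> mpol \<Rightarrow> (nat \<Rightarrow> mpol) \<Rightarrow> bool" where
  "are_evectants d m n \<Phi> \<A> \<longleftrightarrow>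
     (\<forall>i\<le>min d n. is_form d (d + n - 2 * i) (\<A> i)) \<and>
     Gamma_form d m \<Phi> = (\<Sum>i\<le>min d n. bracket_xy ^ i * polarization d n i (\<A> i))"

text \<open>
  The coefficients. All subtractions are on naturals; in \<open>xi_coef\<close> and \<open>eta_coef\<close> none of the
  arguments of \<^const>\<open>fact\<close> is truncated for \<open>r \<le> min n n'\<close>, \<open>s \<le> min d (n + n' - 2 * r)\<close> and \<open>k\<close>, \<open>t\<close> in
  the ranges of summation (additions are performed first for this purpose), while in the bounds of
  summation truncation expresses \<open>max(0, \<dots>)\<close>.
\<close>

definition kappa_coef :: "nat \<Rightarrow> nat \<Rightarrow> nat \<Rightarrow> nat \<Rightarrow> nat \<Rightarrow> nat \<Rightarrow> nat \<Rightarrow> complex" where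
  "kappa_coef d m n m' n' r s =
     fact (n - r) * fact (n' - r) * fact (d + n + n' + 1 - 2 * r - 2 * s) /
     (fact n * fact n' * fact s * fact (d + n + n' + 1 - 2 * r - s) * of_nat (m + m'))"

definition lambda_coef :: "nat \<Rightarrow> nat \<Rightarrow> nat \<Rightarrow> nat \<Rightarrow> nat \<Rightarrow> complex" where
  "lambda_coef r i k n n' =
     (- 1) ^ k * (fact r / (fact k * fact (r - k))) * (fact i / fact (i - k)) *
     (fact (n - i) / fact (n + k - i - r)) * (fact n' / fact (n' - r))"

definition mu_coef :: "nat \<Rightarrow> nat \<Rightarrow> nat \<Rightarrow> nat \<Rightarrow> complex" where
  "mu_coef p q l i =
     (fact l / fact (l - i)) * (fact (p + q + 2 * i + 1 - l) / fact (p + q + i + 1 - l))"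

definition nu_coef :: "nat \<Rightarrow> nat \<Rightarrow> nat \<Rightarrow> nat \<Rightarrow> nat \<Rightarrow> complex" where
  "nu_coef p1 q1 p2 q2 u =
     (\<Sum>t = u - min q1 p2..min p1 (min q2 u).
        (- 1) ^ (u - t) * (fact u / (fact t * fact (u - t))) *
        (fact p1 / fact (p1 - t)) * (fact q1 / fact (q1 + t - u)) *
        (fact p2 / fact (p2 + t - u)) * (fact q2 / fact (q2 - t)))"

definition xi_coef :: "nat \<Rightarrow> nat \<Rightarrow> nat \<Rightarrow> nat \<Rightarrow> nat \<Rightarrow> nat \<Rightarrow> nat \<Rightarrow> nat \<Rightarrow> complex" where
  "xi_coef d m n m' n' r s i =
     kappa_coef d m n m' n' r s * of_nat m *
     (\<Sum>k = max (r + i - n) (i - s)..min i r.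
        lambda_coef r i k n n' *
        mu_coef (d + k - i) (n + n' + k - 2 * r - i) s (i - k) *
        nu_coef (d - i) (n + k - i - r) k (n' - r) (s + k - i))"

definition eta_coef :: "nat \<Rightarrow> nat \<Rightarrow> nat \<Rightarrow> nat \<Rightarrow> nat \<Rightarrow> nat \<Rightarrow> nat \<Rightarrow> nat \<Rightarrow> complex" where
  "eta_coef d m n m' n' r s i =
     (- 1) ^ r * kappa_coef d m n m' n' r s * of_nat m' *
     (\<Sum>k = max (r + i - n') (i - s)..min i r.
        lambda_coef r i k n' n *
        mu_coef (d + k - i) (n + n' + k - 2 * r - i) s (i - k) *
        nu_coef (d - i) (n' + k - i - r) k (n - r) (s + k - i))"

end

theory Submission
  imports Defs
begin

text \<open>
  Write \<open>\<Omega> = \<partial>\<^sup>2/\<partial>x\<^sub>1\<partial>y\<^sub>2 - \<partial>\<^sup>2/\<partial>x\<^sub>2\<partial>y\<^sub>1\<close> and let \<open>\<Lambda>\<^sub>s P\<close> be the result of putting \<open>\<^bold>y = \<^bold>x\<close> in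
  \<open>\<Omega>\<^sup>s P\<close>. The operator \<open>\<Lambda>\<^sub>s\<close> picks the \<open>s\<close>-th term out of a Gordan series: a polarization is
  annihilated by \<open>\<Omega>\<close>, each application of \<open>\<Omega>\<close> lowers the power of \<open>(\<^bold>x \<^bold>y)\<close> by one, and
  \<open>(\<^bold>x \<^bold>y)\<close> vanishes for \<open>\<^bold>y = \<^bold>x\<close>. Hence \<open>\<Lambda>\<^sub>s \<Gamma>\<close> is a nonzero multiple of the \<open>s\<close>-th evectant
  (\<open>omega_of_Gamma_form\<close>).

  The evectant operator \<open>\<E>\<close> is a derivation that commutes with transvection in \<open>\<^bold>y\<close>. So, up to
  a constant factor, \<open>\<Gamma>\<^sub>\<Theta>\<close> is \<open>m (\<Gamma>\<^sub>\<Phi>, \<Psi>(\<^bold>y))\<^sub>r + (-1)\<^sup>r m' (\<Gamma>\<^sub>\<Psi>, \<Phi>(\<^bold>y))\<^sub>r\<close>, the transvectants being taken in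
  \<open>\<^bold>y\<close>, and after expanding \<open>\<Gamma>\<^sub>\<Phi>\<close> and \<open>\<Gamma>\<^sub>\<Psi>\<close> in their Gordan series it remains to find
  \<open>\<Lambda>\<^sub>s ((\<^bold>x \<^bold>y)\<^sup>i \<A>, \<Psi>(\<^bold>y))\<^sub>r\<close> when \<open>\<A>\<close> is the polarization of an arbitrary form \<open>A\<close> of order
  \<open>d + n - 2i\<close> and \<open>\<Psi>\<close> is an arbitrary form of order \<open>n'\<close>. The theorem is therefore an identity
  which is bilinear in \<open>A\<close> and \<open>\<Psi>\<close> (\<open>omega_of_transvection\<close>), and it suffices to check it for powers of linear forms,
  \<open>A = a\<^sub>x\<^bsup>d+n-2i\<^esup>\<close> and \<open>\<Psi> = b\<^sub>x\<^bsup>n'\<^esup>\<close>, since these span (\<open>scalar_linear_form_eqI\<close>).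

  For powers everything is explicit (\<open>omega_of_transvection_powers\<close>), and each of the three
  factors of the coefficient comes from one rule. Transvection with \<open>b\<^sub>y\<^bsup>n'\<^esup>\<close> is iteration of the
  derivation \<open>b\<^sub>2 \<partial>/\<partial>y\<^sub>1 - b\<^sub>1 \<partial>/\<partial>y\<^sub>2\<close>, and the Leibniz rule applied to \<open>(\<^bold>x \<^bold>y)\<^sup>i a\<^sub>x\<^bsup>d-i\<^esup> a\<^sub>y\<^bsup>n-i\<^esup>\<close>
  gives \<open>\<lambda>\<close>. Removing the remaining factor \<open>(\<^bold>x \<^bold>y)\<^bsup>i-k\<^esup>\<close> against \<open>\<Omega>\<^sup>s\<close> gives \<open>\<mu>\<close>
  (\<open>Omega_funpow_bracket_power_mult\<close>). Finally \<open>\<Omega>\<close> acts on \<open>a\<^sub>x\<^bsup>p\<^sub>1\<^esup> a\<^sub>y\<^bsup>q\<^sub>1\<^esup> b\<^sub>x\<^bsup>p\<^sub>2\<^esup> b\<^sub>y\<^bsup>q\<^sub>2\<^esup>\<close> as \<open>(a b)\<close> times a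
  difference of two commuting lowering operators, and the binomial theorem gives \<open>\<nu>\<close>
  (\<open>on_diagonal_Omega_funpow_lin_product\<close>).
\<close>

section \<open>The polynomial ring\<close>

lemma Const_0 [simp]: "Const 0 = 0"
  by (simp add: Const_def)

lemma Const_1 [simp]: "Const 1 = 1"
  by (simp add: Const_def)

lemma Const_add: "Const (a + b) = Const a + Const b"
  by (simp add: Const_def Poly_Mapping.single_add)

lemma Const_mult: "Const (a * b) = Const a * Const b"
  by (simp add: Const_def Poly_Mapping.mult_single)

lemma Const_uminus: "Const (- a) = - Const a"
  by (simp add: Const_def Poly_Mapping.single_uminus)

lemma Const_diff: "Const (a - b) = Const a - Const b"
  by (simp add: Const_def Poly_Mapping.single_diff)

lemma Const_power: "Const (a ^ k) = Const a ^ k"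
  by (induction k) (simp_all add: Const_mult)

lemma Const_of_nat: "Const (of_nat k) = of_nat k"
  by (induction k) (simp_all add: Const_add)

lemma Const_sum: "Const (sum f A) = (\<Sum>x\<in>A. Const (f x))"
  by (induction A rule: infinite_finite_induct) (simp_all add: Const_add)

lemma sum_single_keys:
  "(\<Sum>t\<in>Poly_Mapping.keys p. Poly_Mapping.single t (Poly_Mapping.lookup p t)) = p"
proof (rule poly_mapping_eqI)
  fix w
  show "Poly_Mapping.lookup (\<Sum>t\<in>Poly_Mapping.keys p.
      Poly_Mapping.single t (Poly_Mapping.lookup p t)) w = Poly_Mapping.lookup p w"
    by (simp add: lookup_sum lookup_single when_def in_keys_iff)
qed

lemma mpol_single_induct [case_names single sum]:
  fixes p :: mpol
  assumes single: "\<And>t c. P (Poly_Mapping.single t c)"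
    and sum: "\<And>p q. P p \<Longrightarrow> P q \<Longrightarrow> P (p + q)"
  shows "P p"
proof -
  have "P 0" using single [of 0 0] by simp
  then have "P (\<Sum>t\<in>A. Poly_Mapping.single t (f t))" for A f
    by (induction A rule: infinite_finite_induct) (simp_all add: single sum)
  then show ?thesis by (metis sum_single_keys)
qed

lemma single_eq_monomial:
  "Poly_Mapping.single t c = Const c * (\<Prod>v\<in>Poly_Mapping.keys t. Var v ^ Poly_Mapping.lookup t v)"
proof -
  have pow: "Var v ^ k = Poly_Mapping.single (Poly_Mapping.single v k) 1" for v k
    by (induction k) (simp_all add: Var_def Poly_Mapping.mult_single
        Poly_Mapping.single_add [symmetric])
  have prod: "(\<Prod>v\<in>A. Poly_Mapping.single (f v) (1::complex)) = Poly_Mapping.single (sum f A) 1"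
    for A and f :: "var \<Rightarrow> (var \<Rightarrow>\<^sub>0 nat)"
    by (induction A rule: infinite_finite_induct) (simp_all add: Poly_Mapping.mult_single)
  show ?thesis
    by (simp add: pow prod sum_single_keys Const_def Poly_Mapping.mult_single)
qed

text \<open>
  The ring is generated by constants and variables. This is the induction principle for statements
  that are stable under sums and products, such as the chain rule.
\<close>

lemma mpol_induct [case_names Const Var add mult]:
  assumes "\<And>c. P (Const c)" and "\<And>v. P (Var v)"
    and add: "\<And>p q. P p \<Longrightarrow> P q \<Longrightarrow> P (p + q)" and mult: "\<And>p q. P p \<Longrightarrow> P q \<Longrightarrow> P (p * q)"
  shows "P p"
proof (induction p rule: mpol_single_induct)
  case (single t c)
  have one: "P 1" using assms(1) [of 1] by simp
  have pow: "P (Var v ^ k)" for v k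
    by (induction k) (auto intro: one mult assms(2))
  have "P (\<Prod>v\<in>A. Var v ^ f v)" for A f
    by (induction A rule: infinite_finite_induct) (auto intro: one mult pow)
  then show ?case
    by (subst single_eq_monomial) (intro mult assms(1))
qed (rule add)

text \<open>
  Both \<^const>\<open>pdiff\<close> and \<^const>\<open>subst\<close> are sums over the support. The support of a sum may shrink by
  cancellation; terms that vanish at coefficient \<open>0\<close> allow every sum to be taken over the union of
  the supports.
\<close>

lemma sum_keys_add:
  fixes p q :: mpol and f :: "(var \<Rightarrow>\<^sub>0 nat) \<Rightarrow> complex \<Rightarrow> 'b::comm_monoid_add"
  assumes zero: "\<And>t. f t 0 = 0" and add: "\<And>t a b. f t (a + b) = f t a + f t b"
  shows "(\<Sum>t\<in>Poly_Mapping.keys (p + q). f t (Poly_Mapping.lookup (p + q) t)) =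
    (\<Sum>t\<in>Poly_Mapping.keys p. f t (Poly_Mapping.lookup p t)) +
    (\<Sum>t\<in>Poly_Mapping.keys q. f t (Poly_Mapping.lookup q t))"
proof -
  let ?K = "Poly_Mapping.keys p \<union> Poly_Mapping.keys q"
  have extend: "(\<Sum>t\<in>Poly_Mapping.keys s. f t (Poly_Mapping.lookup s t)) =
      (\<Sum>t\<in>?K. f t (Poly_Mapping.lookup s t))" if "Poly_Mapping.keys s \<subseteq> ?K" for s
    using that by (intro sum.mono_neutral_left) (auto simp: in_keys_iff zero)
  show ?thesis
    unfolding extend [OF Poly_Mapping.keys_add]
    by (simp add: extend lookup_add add sum.distrib)
qed

lemma subst_add:
  assumes "h 0 = 0" and "\<And>a b. h (a + b) = h a + h b"
  shows "subst h \<sigma> (p + q) = subst h \<sigma> p + subst h \<sigma> q"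
  unfolding subst_def
  by (rule sum_keys_add) (simp_all add: assms distrib_right)

lemma subst_single:
  assumes "h 0 = 0"
  shows "subst h \<sigma> (Poly_Mapping.single t c) =
    h c * (\<Prod>v\<in>Poly_Mapping.keys t. \<sigma> v ^ Poly_Mapping.lookup t v)"
  by (cases "c = 0") (simp_all add: subst_def assms)

lemma prod_keys_add:
  fixes s t :: "var \<Rightarrow>\<^sub>0 nat" and \<sigma> :: "var \<Rightarrow> 'b::comm_semiring_1"
  shows "(\<Prod>v\<in>Poly_Mapping.keys (s + t). \<sigma> v ^ Poly_Mapping.lookup (s + t) v) =
    (\<Prod>v\<in>Poly_Mapping.keys s. \<sigma> v ^ Poly_Mapping.lookup s v) *
    (\<Prod>v\<in>Poly_Mapping.keys t. \<sigma> v ^ Poly_Mapping.lookup t v)"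
proof -
  let ?K = "Poly_Mapping.keys s \<union> Poly_Mapping.keys t"
  have extend: "(\<Prod>v\<in>Poly_Mapping.keys r. \<sigma> v ^ Poly_Mapping.lookup r v) =
      (\<Prod>v\<in>?K. \<sigma> v ^ Poly_Mapping.lookup r v)" if "Poly_Mapping.keys r \<subseteq> ?K" for r
    using that by (intro prod.mono_neutral_left) (auto simp: in_keys_iff)
  show ?thesis
    unfolding extend [OF Poly_Mapping.keys_add]
    by (simp add: extend lookup_add power_add prod.distrib)
qed

lemma subst_mult:
  fixes p q :: mpol
  assumes "h 0 = 0" and "\<And>a b. h (a + b) = h a + h b" and "\<And>a b. h (a * b) = h a * h b"
  shows "subst h \<sigma> (p * q) = subst h \<sigma> p * subst h \<sigma> q"
proof (induction p rule: mpol_single_induct)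
  case (single s a)
  show ?case
  proof (induction q rule: mpol_single_induct)
    case (single t b)
    show ?case
      by (simp add: Poly_Mapping.mult_single subst_single assms prod_keys_add mult_ac)
  next
    case (sum q q')
    then show ?case by (simp add: distrib_left subst_add assms(1,2))
  qed
next
  case (sum p p')
  then show ?case by (simp add: distrib_right subst_add assms(1,2))
qed

lemma pdiff_single:
  "pdiff v (Poly_Mapping.single t c) =
    Poly_Mapping.single (t - Poly_Mapping.single v 1) (of_nat (Poly_Mapping.lookup t v) * c)"
  by (cases "c = 0") (simp_all add: pdiff_def)

lemma pdiff_add: "pdiff v (p + q) = pdiff v p + pdiff v q"
  unfolding pdiff_def
  by (rule sum_keys_add) (simp_all add: distrib_left Poly_Mapping.single_add)

lemma pdiff_mult_single:
  "pdiff v (Poly_Mapping.single s a * Poly_Mapping.single t b) =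
    pdiff v (Poly_Mapping.single s a) * Poly_Mapping.single t b +
    Poly_Mapping.single s a * pdiff v (Poly_Mapping.single t b)"
proof -
  let ?e = "Poly_Mapping.single v (1::nat)"
  have shift: "Poly_Mapping.single (s + t - ?e) (of_nat (Poly_Mapping.lookup s v) * a * b) =
      Poly_Mapping.single (s - ?e + t) (of_nat (Poly_Mapping.lookup s v) * a * b)"
    for s t :: "var \<Rightarrow>\<^sub>0 nat" and a b :: complex
  proof (cases "Poly_Mapping.lookup s v = 0")
    case False
    then have "s + t - ?e = s - ?e + t"
      by (intro poly_mapping_eqI) (auto simp: lookup_add lookup_minus lookup_single when_def)
    then show ?thesis by simp
  qed simp
  show ?thesis
    using shift [of s t a b] shift [of t s b a]
    by (simp add: Poly_Mapping.mult_single pdiff_single lookup_add algebra_simps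
        Poly_Mapping.single_add)
qed

text \<open>
  Both sides are biadditive, so the Leibniz rule only has to be verified for monomials.
\<close>

lemma pdiff_mult: "pdiff v (p * q) = pdiff v p * q + p * pdiff v q"
proof (induction p rule: mpol_single_induct)
  case (single s a)
  show ?case
  proof (induction q rule: mpol_single_induct)
    case (single t b)
    show ?case by (rule pdiff_mult_single)
  next
    case (sum q q')
    then show ?case by (simp add: distrib_left pdiff_add algebra_simps)
  qed
next
  case (sum p p')
  then show ?case by (simp add: distrib_right pdiff_add algebra_simps)
qed

lemma pdiff_Const [simp]: "pdiff v (Const c) = 0"
  by (simp add: Const_def pdiff_single)

lemma pdiff_Var [simp]: "pdiff v (Var w) = (if v = w then 1 else 0)"
  by (auto simp: Var_def pdiff_single lookup_single)

lemma pdiff_commute: "pdiff v (pdiff w p) = pdiff w (pdiff v p)"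
proof (induction p rule: mpol_single_induct)
  case (single t c)
  have "t - Poly_Mapping.single v (1::nat) - Poly_Mapping.single w 1 =
      t - Poly_Mapping.single w 1 - Poly_Mapping.single v 1"
    by (intro poly_mapping_eqI) (simp add: lookup_minus)
  then show ?case
    by (cases "v = w") (simp_all add: pdiff_single lookup_minus lookup_single algebra_simps)
qed (simp add: pdiff_add)

lemma pdiff_Const_mult: "pdiff v (Const c * p) = Const c * pdiff v p"
  by (simp add: pdiff_mult)

lemma lookup_Const_mult: "Poly_Mapping.lookup (Const c * p) t = c * Poly_Mapping.lookup p t"
  by (induction p rule: mpol_single_induct)
    (simp_all add: Const_def Poly_Mapping.mult_single lookup_single when_def distrib_left lookup_add)

subsection \<open>Substitutions\<close>

abbreviation substitute :: "(var \<Rightarrow> mpol) \<Rightarrow> mpol \<Rightarrow> mpol" where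
  "substitute \<equiv> subst Const"

lemma substitute_add: "substitute \<sigma> (p + q) = substitute \<sigma> p + substitute \<sigma> q"
  by (rule subst_add) (simp_all add: Const_add)

lemma substitute_mult: "substitute \<sigma> (p * q) = substitute \<sigma> p * substitute \<sigma> q"
  by (rule subst_mult) (simp_all add: Const_add Const_mult)

lemma substitute_Const [simp]: "substitute \<sigma> (Const c) = Const c"
  using subst_single [of Const \<sigma> 0 c] by (simp add: Const_def [symmetric])

lemma substitute_Var [simp]: "substitute \<sigma> (Var v) = \<sigma> v"
  unfolding Var_def by (subst subst_single) simp_all

lemma substitute_1 [simp]: "substitute \<sigma> 1 = 1"
  using substitute_Const [of \<sigma> 1] by simp

lemma substitute_0 [simp]: "substitute \<sigma> 0 = 0"
  using substitute_Const [of \<sigma> 0] by simp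

lemma substitute_diff: "substitute \<sigma> (p - q) = substitute \<sigma> p - substitute \<sigma> q"
  using substitute_add [of \<sigma> "p - q" q] by simp

lemma substitute_power: "substitute \<sigma> (p ^ k) = substitute \<sigma> p ^ k"
  by (induction k) (simp_all add: substitute_mult)

lemma substitute_sum: "substitute \<sigma> (sum f A) = (\<Sum>x\<in>A. substitute \<sigma> (f x))"
  by (induction A rule: infinite_finite_induct) (simp_all add: substitute_add)

lemma in_y_eq: "in_y = substitute (\<lambda>v. Var (y_of_x v))"
  by (simp add: in_y_def fun_eq_iff)

text \<open>
  The chain rule. The second summand accounts for occurrences of \<open>\<^bold>y\<close> in \<open>p\<close> itself and vanishes
  for forms in \<open>\<^bold>x\<close>.
\<close>

lemma pdiff_in_y:
  "pdiff Y1 (in_y p) = in_y (pdiff X1 p) + in_y (pdiff Y1 p)"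
  "pdiff Y2 (in_y p) = in_y (pdiff X2 p) + in_y (pdiff Y2 p)"
proof (induction p rule: mpol_induct)
  case (Var v)
  { case 1 show ?case by (cases v) (simp_all add: in_y_eq)
  next case 2 show ?case by (cases v) (simp_all add: in_y_eq) }
next
  case (mult p q)
  { case 1 show ?case using mult by (simp add: in_y_eq pdiff_mult substitute_add substitute_mult algebra_simps)
  next case 2 show ?case using mult by (simp add: in_y_eq pdiff_mult substitute_add substitute_mult algebra_simps) }
qed (simp_all add: in_y_eq pdiff_add substitute_add algebra_simps)

section \<open>Derivations\<close>

text \<open>
  An abstract binomial theorem: whenever \<open>D\<close> raises either one or the other of two indices, the
  paths that lead from \<open>(0, 0)\<close> to \<open>(k, r - k)\<close> are counted by the binomial coefficient. It yields the
  Leibniz rule, the expansion of powers of a directional derivative, and the powers of \<open>\<Omega>\<close>.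
\<close>

lemma funpow_binomial:
  fixes D :: "'a::comm_ring_1 \<Rightarrow> 'a"
  assumes add: "\<And>p q. D (p + q) = D p + D q"
    and step: "\<And>k l. D (F k l) = F (Suc k) l + F k (Suc l)"
  shows "(D ^^ r) (F 0 0) = (\<Sum>k\<le>r. of_nat (r choose k) * F k (r - k))"
  using step
proof (induction r arbitrary: F)
  case (Suc r)
  have add': "(D ^^ r) (p + q) = (D ^^ r) p + (D ^^ r) q" for p q
    by (induction r) (simp_all add: add)
  have first: "(\<Sum>k\<le>r. of_nat (r choose k) * F k (Suc (r - k))) =
      F 0 (Suc r) + (\<Sum>k\<le>r. of_nat (r choose Suc k) * F (Suc k) (r - k))"
  proof -
    have "(\<Sum>k\<le>r. of_nat (r choose k) * F k (Suc (r - k))) =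
        (\<Sum>k\<le>r. of_nat (r choose k) * F k (Suc r - k))"
      by (intro sum.cong) (auto simp: Suc_diff_le)
    also have "\<dots> = (\<Sum>k\<le>Suc r. of_nat (r choose k) * F k (Suc r - k))"
      by (simp add: binomial_eq_0)
    also have "\<dots> = F 0 (Suc r) + (\<Sum>k\<le>r. of_nat (r choose Suc k) * F (Suc k) (r - k))"
      by (subst sum.atMost_Suc_shift) simp
    finally show ?thesis .
  qed
  have "(D ^^ Suc r) (F 0 0) = (D ^^ r) (F (Suc 0) 0) + (D ^^ r) (F 0 (Suc 0))"
    by (simp add: funpow_Suc_right Suc.prems add' del: funpow.simps)
  also have "\<dots> = (\<Sum>k\<le>r. of_nat (r choose k) * F (Suc k) (r - k)) +
      (\<Sum>k\<le>r. of_nat (r choose k) * F k (Suc (r - k)))"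
    using Suc.IH [of "\<lambda>k l. F (Suc k) l"] Suc.IH [of "\<lambda>k l. F k (Suc l)"] Suc.prems by simp
  also have "\<dots> = (\<Sum>k\<le>Suc r. of_nat (Suc r choose k) * F k (Suc r - k))"
    unfolding first by (subst sum.atMost_Suc_shift) (simp add: algebra_simps sum.distrib)
  finally show ?case .
qed simp

text \<open>
  The falling factorial \<open>n (n - 1) \<cdots> (n - k + 1)\<close>. Truncated subtraction makes it vanish for
  \<open>n < k\<close>, so that sums can run over full ranges; the bounds of summation in \<^const>\<open>nu_coef\<close> and
  \<^const>\<open>xi_coef\<close> only remove terms containing such a zero factor.
\<close>

definition ffact :: "nat \<Rightarrow> nat \<Rightarrow> nat" where
  "ffact n k = (\<Prod>i<k. n - i)"

lemma ffact_0 [simp]: "ffact n 0 = 1"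
  by (simp add: ffact_def)

lemma ffact_Suc: "ffact n (Suc k) = ffact n k * (n - k)"
  by (simp add: ffact_def)

lemma ffact_eq_0: "n < k \<Longrightarrow> ffact n k = 0"
  by (auto simp: ffact_def intro!: bexI [of _ n])

lemma ffact_mult_fact: "k \<le> n \<Longrightarrow> ffact n k * fact (n - k) = fact n"
proof (induction k)
  case (Suc k)
  then have "n - k = Suc (n - Suc k)" by simp
  then have "fact (n - k) = (n - k) * fact (n - Suc k)"
    by (metis fact_Suc of_nat_id)
  with Suc show ?case by (simp add: ffact_Suc mult_ac)
qed simp

lemma of_nat_ffact:
  assumes "k \<le> n"
  shows "(of_nat (ffact n k) :: complex) = fact n / fact (n - k)"
proof -
  have "of_nat (ffact n k * fact (n - k)) = (of_nat (fact n) :: complex)"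
    by (simp only: ffact_mult_fact [OF assms])
  then have "of_nat (ffact n k) * fact (n - k) = (fact n :: complex)"
    by (simp only: of_nat_mult of_nat_fact)
  then show ?thesis
    by (simp add: eq_divide_eq)
qed

lemma ffact_Suc': "ffact n (Suc k) = n * ffact (n - 1) k"
  by (simp add: ffact_def prod.lessThan_Suc_shift del: prod.lessThan_Suc)

locale derivation =
  fixes D :: "mpol \<Rightarrow> mpol"
  assumes add: "D (p + q) = D p + D q"
    and mult: "D (p * q) = D p * q + p * D q"
    and Const [simp]: "D (Const c) = 0"
begin

lemma zero [simp]: "D 0 = 0"
  using add [of 0 0] by simp

lemma one [simp]: "D 1 = 0"
  using Const [of 1] by simp

lemma of_nat [simp]: "D (of_nat k) = 0"
  using Const [of "of_nat k"] by (simp add: Const_of_nat)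

lemma uminus: "D (- p) = - D p"
  using add [of p "- p"] by (simp add: add_eq_0_iff)

lemma diff: "D (p - q) = D p - D q"
  using add [of p "- q"] by (simp add: uminus)

lemma sum: "D (sum f I) = (\<Sum>i\<in>I. D (f i))"
  by (induction I rule: infinite_finite_induct) (simp_all add: add)

lemma power: "D (p ^ n) = of_nat n * p ^ (n - 1) * D p"
proof (induction n)
  case (Suc n)
  then show ?case by (cases n) (simp_all add: mult algebra_simps)
qed simp

lemma power_eigen:
  assumes "D p = c * p"
  shows "D (p ^ n) = of_nat n * c * p ^ n"
proof (cases n)
  case (Suc k)
  have "D (p ^ Suc k) = of_nat (Suc k) * p ^ k * D p"
    by (simp only: power diff_Suc_1)
  then show ?thesis
    by (simp only: Suc assms power_Suc mult_ac)
qed simp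

lemma funpow_power:
  assumes "D (D p) = 0"
  shows "(D ^^ k) (p ^ n) = of_nat (ffact n k) * D p ^ k * p ^ (n - k)"
proof (induction k)
  case (Suc k)
  then show ?case
    using assms by (simp add: mult power ffact_Suc mult_ac)
qed simp

lemma leibniz:
  "(D ^^ r) (p * q) = (\<Sum>k\<le>r. of_nat (r choose k) * ((D ^^ k) p * (D ^^ (r - k)) q))"
  using funpow_binomial [of D "\<lambda>k l. (D ^^ k) p * (D ^^ l) q" r]
  by (simp add: add mult)

lemma funpow_const_mult:
  assumes "D c = 0"
  shows "(D ^^ k) (c * p) = c * (D ^^ k) p"
  by (induction k) (simp_all add: mult assms)

end

interpretation pdiff: derivation "pdiff v" for v
  by unfold_locales (simp_all add: pdiff_add pdiff_mult)

lemma derivation_combination: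
  assumes "derivation D" and "derivation D'"
  shows "derivation (\<lambda>p. f * D p + g * D' p)"
proof -
  interpret D: derivation D by fact
  interpret D': derivation D' by fact
  show ?thesis
    by unfold_locales (simp_all add: D.add D'.add D.mult D'.mult algebra_simps)
qed

section \<open>Reduction to powers of linear forms\<close>

text \<open>
  Scalars are the constants of all derivations and substitutions in \<open>\<^bold>x\<close> and \<open>\<^bold>y\<close> used below.
  Monomials in the \<open>a\<^sub>i\<close> suffice to write every form as a combination of monomials in \<open>x\<^sub>1, x\<^sub>2\<close>.
\<close>

inductive scalar :: "mpol \<Rightarrow> bool" where
  Const: "scalar (Const c)"
| Coef: "scalar (Var (Coef i))"
| mult: "scalar p \<Longrightarrow> scalar q \<Longrightarrow> scalar (p * q)"

lemma pdiff_scalar: "scalar c \<Longrightarrow> v \<in> {X1, X2, Y1, Y2} \<Longrightarrow> pdiff v c = 0"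
  by (induction rule: scalar.induct) (auto simp: pdiff_mult)

lemma substitute_scalar:
  assumes "scalar c" and "\<And>i. \<sigma> (Coef i) = Var (Coef i)"
  shows "substitute \<sigma> c = c"
  using assms by (induction rule: scalar.induct) (auto simp: substitute_mult)

definition scalar_linear :: "(mpol \<Rightarrow> mpol) \<Rightarrow> bool" where
  "scalar_linear L \<longleftrightarrow>
     (\<forall>p q. L (p + q) = L p + L q) \<and> (\<forall>c p. scalar c \<longrightarrow> L (c * p) = c * L p)"

lemma scalar_linear_id: "scalar_linear (\<lambda>p. p)"
  by (simp add: scalar_linear_def)

lemma scalar_linear_mult: "scalar_linear L \<Longrightarrow> scalar_linear (\<lambda>p. f * L p)"
  by (simp add: scalar_linear_def distrib_left mult_ac)

lemma scalar_linear_add: "scalar_linear L \<Longrightarrow> scalar_linear M \<Longrightarrow> scalar_linear (\<lambda>p. L p + M p)"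
  by (simp add: scalar_linear_def algebra_simps)

lemma scalar_linear_diff: "scalar_linear L \<Longrightarrow> scalar_linear M \<Longrightarrow> scalar_linear (\<lambda>p. L p - M p)"
  by (simp add: scalar_linear_def algebra_simps)

lemma scalar_linear_comp:
  "scalar_linear L \<Longrightarrow> scalar_linear M \<Longrightarrow> scalar_linear (\<lambda>p. L (M p))"
  by (simp add: scalar_linear_def)

lemma scalar_linear_funpow:
  assumes "scalar_linear L"
  shows "scalar_linear (L ^^ k)"
  using assms by (induction k) (simp_all add: scalar_linear_def)

lemma scalar_linear_pdiff: "v \<in> {X1, X2, Y1, Y2} \<Longrightarrow> scalar_linear (pdiff v)"
  by (simp add: scalar_linear_def pdiff_add pdiff_mult pdiff_scalar)

lemma scalar_linear_substitute:
  "(\<And>i. \<sigma> (Coef i) = Var (Coef i)) \<Longrightarrow> scalar_linear (substitute \<sigma>)"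
  by (simp add: scalar_linear_def substitute_add substitute_mult substitute_scalar)

text \<open>
  Each coefficient of the left-hand side is a complex polynomial in \<open>u\<close> that vanishes identically.
\<close>

lemma polynomial_identity:
  assumes "\<And>u. (\<Sum>j\<le>n. Const (u ^ j) * f j) = 0" and "j \<le> n"
  shows "f j = 0"
proof (rule poly_mapping_eqI)
  fix t
  have "(\<Sum>j\<le>n. Poly_Mapping.lookup (f j) t * u ^ j) = 0" for u
  proof -
    have "(\<Sum>j\<le>n. Poly_Mapping.lookup (f j) t * u ^ j) =
        Poly_Mapping.lookup (\<Sum>j\<le>n. Const (u ^ j) * f j) t"
      by (simp add: lookup_sum lookup_Const_mult, simp only: mult.commute)
    then show ?thesis using assms(1) [of u] by simp
  qed
  with polyfun_eq_0 [of "\<lambda>j. Poly_Mapping.lookup (f j) t" n] assms(2)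
  show "Poly_Mapping.lookup (f j) t = Poly_Mapping.lookup 0 t" by auto
qed

definition lin_x :: "complex \<Rightarrow> mpol" where
  "lin_x u = Var X1 + Const u * Var X2"

definition lin_y :: "complex \<Rightarrow> mpol" where
  "lin_y u = Var Y1 + Const u * Var Y2"

lemma single_form_decompose:
  assumes "Poly_Mapping.keys t \<subseteq> {X1, X2} \<union> Coef ` I"
  obtains c where "scalar c" and "Poly_Mapping.single t a =
    c * (Var X1 ^ Poly_Mapping.lookup t X1 * Var X2 ^ Poly_Mapping.lookup t X2)"
proof -
  let ?g = "\<lambda>v. Var v ^ Poly_Mapping.lookup t v"
  let ?K = "Poly_Mapping.keys t - {X1, X2}"
  have pow: "scalar (Var (Coef i) ^ k)" for i k
    using scalar.Const [of 1] by (induction k) (auto intro: scalar.intros)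
  have one: "scalar 1" using scalar.Const [of 1] by simp
  have "scalar (prod ?g A)" if "A \<subseteq> Coef ` I" for A
    using that by (induction A rule: infinite_finite_induct) (auto intro: scalar.mult one pow)
  then have "scalar (Const a * prod ?g ?K)"
    using assms by (intro scalar.mult scalar.Const) blast
  moreover have "prod ?g (Poly_Mapping.keys t) = prod ?g (?K \<union> {X1, X2})"
    by (intro prod.mono_neutral_left) (auto simp: in_keys_iff)
  then have "prod ?g (Poly_Mapping.keys t) = prod ?g ?K * (?g X1 * ?g X2)"
    by (simp add: prod.union_disjoint)
  ultimately show thesis
    using that by (simp add: single_eq_monomial mult_ac)
qed

text \<open>
  Powers of linear forms \<open>x\<^sub>1 + u x\<^sub>2\<close> span the forms of order \<open>n\<close>: the difference of the two operators,
  applied to \<open>(x\<^sub>1 + u x\<^sub>2)\<^sup>n\<close>, is a polynomial in \<open>u\<close> whose coefficients are nonzero multiples of its values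
  at the monomials \<open>x\<^sub>1\<^bsup>n-j\<^esup> x\<^sub>2\<^sup>j\<close>.
\<close>

lemma scalar_linear_form_eqI:
  assumes L: "scalar_linear L" and L': "scalar_linear L'"
    and eq: "\<And>u. L (lin_x u ^ n) = L' (lin_x u ^ n)" and form: "is_form d n A"
  shows "L A = L' A"
proof -
  define M where "M p = L p - L' p" for p
  have M: "scalar_linear M"
    unfolding M_def by (intro scalar_linear_diff L L')
  have M_0: "M 0 = 0"
    using M by (metis add_cancel_right_left scalar_linear_def)
  have M_sum: "M (sum f I) = (\<Sum>i\<in>I. M (f i))" for f and I :: "'i set"
    using M M_0 by (induction I rule: infinite_finite_induct) (simp_all add: scalar_linear_def)
  have M_scalar: "M (c * p) = c * M p" if "scalar c" for c p
    using M that by (simp add: scalar_linear_def)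
  have mono: "M (Var X1 ^ (n - j) * Var X2 ^ j) = 0" if "j \<le> n" for j
  proof -
    have "(\<Sum>j\<le>n. Const (u ^ j) * (Const (of_nat (n choose j)) *
        M (Var X1 ^ (n - j) * Var X2 ^ j))) = 0" for u
    proof -
      have "lin_x u ^ n = (\<Sum>j\<le>n. Const (u ^ j * of_nat (n choose j)) *
          (Var X1 ^ (n - j) * Var X2 ^ j))"
        unfolding lin_x_def add.commute [of "Var X1"] binomial_ring
        by (intro sum.cong) (simp_all add: Const_mult Const_power Const_of_nat
            power_mult_distrib mult_ac)
      moreover have "M (lin_x u ^ n) = 0"
        by (simp add: M_def eq)
      ultimately show ?thesis
        by (simp add: M_sum M_scalar scalar.Const Const_mult mult.assoc)
    qed
    from polynomial_identity [OF this that]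
    have "Const (1 / of_nat (n choose j)) * (Const (of_nat (n choose j)) *
        M (Var X1 ^ (n - j) * Var X2 ^ j)) = 0" by simp
    moreover have "of_nat (n choose j) \<noteq> (0 :: complex)" using that by simp
    ultimately show ?thesis
      by (simp add: mult.assoc [symmetric] Const_mult [symmetric])
  qed
  have "M (Poly_Mapping.single t (Poly_Mapping.lookup A t)) = 0"
    if "t \<in> Poly_Mapping.keys A" for t
  proof -
    have keys: "Poly_Mapping.keys t \<subseteq> {X1, X2} \<union> Coef ` {..d}"
      and order: "Poly_Mapping.lookup t X1 + Poly_Mapping.lookup t X2 = n"
      using form that by (auto simp: is_form_def)
    obtain c where c: "scalar c" "Poly_Mapping.single t (Poly_Mapping.lookup A t) =
        c * (Var X1 ^ Poly_Mapping.lookup t X1 * Var X2 ^ Poly_Mapping.lookup t X2)"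
      by (rule single_form_decompose [OF keys])
    have "Poly_Mapping.lookup t X1 = n - Poly_Mapping.lookup t X2"
      "Poly_Mapping.lookup t X2 \<le> n" using order by auto
    then show ?thesis
      using c mono by (simp add: M_scalar)
  qed
  then have "M (\<Sum>t\<in>Poly_Mapping.keys A. Poly_Mapping.single t (Poly_Mapping.lookup A t)) = 0"
    by (simp add: M_sum)
  then show ?thesis
    by (simp add: sum_single_keys M_def)
qed

section \<open>The Omega process\<close>

fun x_of_y :: "var \<Rightarrow> var" where
  "x_of_y Y1 = X1"
| "x_of_y Y2 = X2"
| "x_of_y v = v"

definition on_diagonal :: "mpol \<Rightarrow> mpol" where
  "on_diagonal = substitute (\<lambda>v. Var (x_of_y v))"

lemma on_diagonal_Const [simp]: "on_diagonal (Const c) = Const c"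
  by (simp add: on_diagonal_def)

lemma on_diagonal_add: "on_diagonal (p + q) = on_diagonal p + on_diagonal q"
  by (simp add: on_diagonal_def substitute_add)

lemma on_diagonal_mult: "on_diagonal (p * q) = on_diagonal p * on_diagonal q"
  by (simp add: on_diagonal_def substitute_mult)

lemma on_diagonal_power: "on_diagonal (p ^ k) = on_diagonal p ^ k"
  by (simp add: on_diagonal_def substitute_power)

lemma on_diagonal_sum: "on_diagonal (sum f A) = (\<Sum>x\<in>A. on_diagonal (f x))"
  by (simp add: on_diagonal_def substitute_sum)

lemma on_diagonal_bracket: "on_diagonal bracket_xy = 0"
  by (simp add: on_diagonal_def bracket_xy_def substitute_diff substitute_mult mult.commute)

lemma on_diagonal_lin [simp]:
  "on_diagonal (lin_x u) = lin_x u" "on_diagonal (lin_y u) = lin_x u"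
  by (simp_all add: on_diagonal_def lin_x_def lin_y_def substitute_add substitute_mult)

definition Omega :: "mpol \<Rightarrow> mpol" where
  "Omega p = pdiff X1 (pdiff Y2 p) - pdiff X2 (pdiff Y1 p)"

definition euler :: "mpol \<Rightarrow> mpol" where
  "euler p = Var X1 * pdiff X1 p + Var X2 * pdiff X2 p + Var Y1 * pdiff Y1 p + Var Y2 * pdiff Y2 p"

interpretation euler: derivation euler
  by unfold_locales (simp_all add: euler_def pdiff_add pdiff_mult algebra_simps)

lemma Omega_add: "Omega (p + q) = Omega p + Omega q"
  by (simp add: Omega_def pdiff_add)

lemma Omega_Const_mult: "Omega (Const c * p) = Const c * Omega p"
  by (simp add: Omega_def pdiff_mult algebra_simps)

lemma Omega_funpow_add: "(Omega ^^ s) (p + q) = (Omega ^^ s) p + (Omega ^^ s) q"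
  by (induction s) (simp_all add: Omega_add)

lemma Omega_funpow_Const_mult: "(Omega ^^ s) (Const c * p) = Const c * (Omega ^^ s) p"
  by (induction s) (simp_all add: Omega_Const_mult)

lemma Omega_funpow_0: "(Omega ^^ s) 0 = 0"
  using Omega_funpow_Const_mult [of s 0 0] by simp

lemma Omega_bracket_mult: "Omega (bracket_xy * p) = bracket_xy * Omega p + (euler p + 2 * p)"
  by (simp add: Omega_def bracket_xy_def euler_def pdiff_mult pdiff.diff pdiff_add algebra_simps
      pdiff_commute [of Y2] pdiff_commute [of Y1])

lemma euler_bracket: "euler bracket_xy = 2 * bracket_xy"
  by (simp add: bracket_xy_def euler_def pdiff_mult pdiff.diff algebra_simps)

lemma euler_pdiff: "v \<in> {X1, X2, Y1, Y2} \<Longrightarrow> euler (pdiff v p) = pdiff v (euler p) - pdiff v p"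
  by (auto simp: euler_def pdiff_add pdiff_mult pdiff_commute [of v])

lemma euler_Omega: "euler (Omega p) = Omega (euler p) - 2 * Omega p"
  by (simp add: Omega_def euler.diff euler_pdiff pdiff.diff)

lemma numeral_eq_Const: "numeral k = Const (numeral k)"
  using Const_of_nat [of "numeral k"] by simp

text \<open>
  The commutation relation behind Cayley's identity. By \<open>Omega_bracket_mult\<close>, moving \<open>\<Omega>\<close> past one factor
  \<open>(\<^bold>x \<^bold>y)\<close> costs the total degree plus two, and the degree is \<open>N + 2j\<close> after \<open>j\<close> factors. The degree
  enters only as an eigenvalue of the Euler operator; letting it be a complex number avoids all case
  distinctions for \<open>\<Omega> p = 0\<close>.
\<close>

lemma Omega_bracket_power_mult:
  assumes "euler p = Const N * p"
  shows "Omega (bracket_xy ^ Suc j * p) =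
    bracket_xy ^ Suc j * Omega p + Const (of_nat (Suc j) * (N + of_nat j + 2)) * (bracket_xy ^ j * p)"
proof (induction j)
  case 0
  show ?case
    using assms by (simp add: Omega_bracket_mult Const_add numeral_eq_Const [symmetric] algebra_simps)
next
  case (Suc j)
  let ?c = "of_nat (Suc j) * (N + of_nat j + 2)"
  have "euler (bracket_xy ^ Suc j * p) = of_nat (Suc j) * 2 * bracket_xy ^ Suc j * p +
      bracket_xy ^ Suc j * (Const N * p)"
    by (simp only: euler.mult euler.power_eigen [OF euler_bracket] assms)
  also have "\<dots> = Const (N + 2 * of_nat (Suc j)) * (bracket_xy ^ Suc j * p)"
    by (simp only: Const_add Const_mult Const_of_nat numeral_eq_Const [symmetric]
        distrib_left distrib_right mult_ac add_ac)
  finally have e: "euler (bracket_xy ^ Suc j * p) =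
      Const (N + 2 * of_nat (Suc j)) * (bracket_xy ^ Suc j * p)" .
  have c: "?c + (N + 2 * of_nat (Suc j) + 2) = of_nat (Suc (Suc j)) * (N + of_nat (Suc j) + 2)"
    by (simp add: algebra_simps)
  have "Omega (bracket_xy ^ Suc (Suc j) * p) =
      bracket_xy * Omega (bracket_xy ^ Suc j * p) +
      (euler (bracket_xy ^ Suc j * p) + 2 * (bracket_xy ^ Suc j * p))"
    by (simp only: power_Suc [of _ "Suc j"] mult.assoc Omega_bracket_mult)
  also have "\<dots> = bracket_xy * (bracket_xy ^ Suc j * Omega p) +
      (Const ?c + (Const (N + 2 * of_nat (Suc j)) + Const 2)) * (bracket_xy ^ Suc j * p)"
    unfolding Suc.IH e numeral_eq_Const [symmetric]
    by (simp only: distrib_left distrib_right mult_ac add_ac power_Suc)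
  also have "\<dots> = bracket_xy ^ Suc (Suc j) * Omega p +
      Const (of_nat (Suc (Suc j)) * (N + of_nat (Suc j) + 2)) * (bracket_xy ^ Suc j * p)"
    by (simp only: Const_add [symmetric] c power_Suc [of _ "Suc j"] mult.assoc)
  finally show ?case .
qed

text \<open>
  The recurrence for the constant in the next lemma that results from applying \<open>\<Omega>\<close> once.
\<close>

lemma cayley_coefficient_Suc:
  fixes N :: complex
  shows "of_nat (ffact s (Suc i)) * pochhammer (N - 2 - of_nat s + of_nat (Suc i) + 2) (Suc i) +
      of_nat (Suc i) * (N + of_nat i + 2) *
        (of_nat (ffact s i) * pochhammer (N - of_nat s + of_nat i + 2) i) =
    of_nat (ffact (Suc s) (Suc i)) * pochhammer (N - of_nat (Suc s) + of_nat (Suc i) + 2) (Suc i)"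
proof -
  define Y where "Y = N - of_nat s + of_nat i + 2"
  define Q where "Q = pochhammer Y i"
  define g where "g = (of_nat (ffact s i) :: complex)"
  have Y: "N - 2 - of_nat s + of_nat (Suc i) + 2 = Y - 1"
    "N - of_nat (Suc s) + of_nat (Suc i) + 2 = Y" "N + of_nat i + 2 = Y + of_nat s"
    by (simp_all add: Y_def)
  have Q: "pochhammer (Y - 1) (Suc i) = (Y - 1) * Q" "pochhammer Y (Suc i) = Q * (Y + of_nat i)"
    using pochhammer_rec [of "Y - 1" i] by (simp_all only: Q_def pochhammer_Suc diff_add_cancel)
  have f: "of_nat (ffact s (Suc i)) = g * (of_nat s - of_nat i)"
    unfolding g_def by (cases "i \<le> s") (simp_all add: ffact_Suc ffact_eq_0)
  have f': "of_nat (ffact (Suc s) (Suc i)) = (1 + of_nat s) * g"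
    by (simp add: g_def ffact_Suc' distrib_right)
  have "g * (a - b) * ((Y - 1) * Q) + (1 + b) * (Y + a) * (g * Q) =
      (1 + a) * g * (Q * (Y + b))" for a b :: complex
    by (simp add: algebra_simps)
  from this [of "of_nat s" "of_nat i"] show ?thesis
    unfolding Y Q f f' Y_def [symmetric] Q_def [symmetric] g_def [symmetric]
    by (simp only: of_nat_Suc add.commute [of _ 1])
qed

text \<open>
  By the commutation relation, one of the \<open>s\<close> operators \<open>\<Omega>\<close> either passes to \<open>p\<close>, lowering its degree by two,
  or consumes a factor \<open>(\<^bold>x \<^bold>y)\<close>. On the diagonal only those terms survive in which all \<open>j\<close>
  factors have been consumed. For \<open>s < j\<close> the falling factorial vanishes, as it should.
\<close>

lemma Omega_funpow_bracket_power_mult: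
  assumes "euler p = Const N * p"
  shows "on_diagonal ((Omega ^^ s) (bracket_xy ^ j * p)) =
    Const (of_nat (ffact s j) * pochhammer (N - of_nat s + of_nat j + 2) j) *
    on_diagonal ((Omega ^^ (s - j)) p)"
  using assms
proof (induction s arbitrary: j N p)
  case 0
  show ?case
    by (cases j) (simp_all add: ffact_eq_0 on_diagonal_mult on_diagonal_bracket)
next
  case (Suc s)
  show ?case
  proof (cases j)
    case (Suc i)
    have 1: "euler (Omega p) = Const (N - 2) * Omega p"
      by (simp add: euler_Omega Suc.prems Omega_Const_mult Const_diff numeral_eq_Const [symmetric]
          left_diff_distrib)
    define \<beta> where "\<beta> = of_nat (ffact s (Suc i)) *
      pochhammer (N - 2 - of_nat s + of_nat (Suc i) + 2) (Suc i)"
    define \<gamma> where "\<gamma> = of_nat (Suc i) * (N + of_nat i + 2) *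
      (of_nat (ffact s i) * pochhammer (N - of_nat s + of_nat i + 2) i)"
    have shift: "Const \<beta> * on_diagonal ((Omega ^^ (s - Suc i)) (Omega p)) =
        Const \<beta> * on_diagonal ((Omega ^^ (s - i)) p)"
    proof (cases "s \<le> i")
      case False
      then have "s - i = Suc (s - Suc i)" by simp
      then show ?thesis by (simp only: funpow_Suc_right comp_apply)
    qed (simp add: ffact_eq_0 \<beta>_def)
    \<comment> \<open>The innermost \<open>\<Omega>\<close> is applied first, so that both resulting terms fall under the induction hypothesis.\<close>
    have "on_diagonal ((Omega ^^ Suc s) (bracket_xy ^ j * p)) =
        on_diagonal ((Omega ^^ s) (bracket_xy ^ Suc i * Omega p)) +
        Const (of_nat (Suc i) * (N + of_nat i + 2)) *
          on_diagonal ((Omega ^^ s) (bracket_xy ^ i * p))"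
      by (simp only: \<open>j = Suc i\<close> funpow_Suc_right comp_apply Omega_bracket_power_mult [OF Suc.prems]
          Omega_funpow_add Omega_funpow_Const_mult on_diagonal_add on_diagonal_mult on_diagonal_Const)
    also have "\<dots> = Const \<beta> * on_diagonal ((Omega ^^ (s - Suc i)) (Omega p)) +
        Const \<gamma> * on_diagonal ((Omega ^^ (s - i)) p)"
      unfolding \<beta>_def \<gamma>_def
      by (simp only: Suc.IH [OF 1] Suc.IH [OF Suc.prems] Const_mult mult.assoc)
    also have "\<dots> = Const (\<beta> + \<gamma>) * on_diagonal ((Omega ^^ (s - i)) p)"
      by (simp only: shift Const_add distrib_right)
    also have "\<beta> + \<gamma> =
        of_nat (ffact (Suc s) (Suc i)) * pochhammer (N - of_nat (Suc s) + of_nat (Suc i) + 2) (Suc i)"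
      unfolding \<beta>_def \<gamma>_def by (rule cayley_coefficient_Suc)
    finally show ?thesis by (simp only: \<open>j = Suc i\<close> diff_Suc_Suc)
  qed simp
qed

text \<open>
  \<open>a\<^sub>x\<^bsup>p\<^sub>1\<^esup> a\<^sub>y\<^bsup>q\<^sub>1\<^esup> b\<^sub>x\<^bsup>p\<^sub>2\<^esup> b\<^sub>y\<^bsup>q\<^sub>2\<^esup>\<close> in symbolic notation, for \<open>a = (1, u)\<close> and \<open>b = (1, w)\<close>; thus
  \<open>(a b) = w - u\<close>.
\<close>

definition lin_product :: "complex \<Rightarrow> complex \<Rightarrow> nat \<Rightarrow> nat \<Rightarrow> nat \<Rightarrow> nat \<Rightarrow> mpol" where
  "lin_product u w p1 q1 p2 q2 = lin_x u ^ p1 * lin_y u ^ q1 * lin_x w ^ p2 * lin_y w ^ q2"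

lemma pdiff_lin [simp]:
  "pdiff X1 (lin_x u) = 1" "pdiff X2 (lin_x u) = Const u"
  "pdiff Y1 (lin_x u) = 0" "pdiff Y2 (lin_x u) = 0"
  "pdiff X1 (lin_y u) = 0" "pdiff X2 (lin_y u) = 0"
  "pdiff Y1 (lin_y u) = 1" "pdiff Y2 (lin_y u) = Const u"
  by (simp_all add: lin_x_def lin_y_def pdiff_add pdiff_mult)

lemma euler_lin_product:
  "euler (lin_product u w p1 q1 p2 q2) = Const (of_nat (p1 + q1 + p2 + q2)) * lin_product u w p1 q1 p2 q2"
proof -
  have "euler (lin_x v) = lin_x v" "euler (lin_y v) = lin_y v" for v
    by (simp_all add: euler_def, simp_all add: lin_x_def lin_y_def algebra_simps)
  then have pow: "euler (lin_x v ^ p) = of_nat p * lin_x v ^ p"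
    "euler (lin_y v ^ p) = of_nat p * lin_y v ^ p" for v p
    using euler.power_eigen [of _ 1] by simp_all
  show ?thesis
    by (simp add: lin_product_def euler.mult pow Const_add Const_of_nat algebra_simps)
qed

text \<open>
  \<open>\<Omega>\<close> pairs a derivative in \<open>\<^bold>x\<close> with one in \<open>\<^bold>y\<close>. The pairs \<open>a\<^sub>x, a\<^sub>y\<close> and \<open>b\<^sub>x, b\<^sub>y\<close> contribute
  \<open>(a a) = (b b) = 0\<close>, the mixed pairs contribute \<open>(a b)\<close> and \<open>(b a) = - (a b)\<close>.
\<close>

lemma Omega_lin_product:
  "Omega (lin_product u w p1 q1 p2 q2) =
    Const ((w - u) * of_nat (p1 * q2)) * lin_product u w (p1 - 1) q1 p2 (q2 - 1) +
    Const ((w - u) * - of_nat (p2 * q1)) * lin_product u w p1 (q1 - 1) (p2 - 1) q2"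
proof -
  \<comment> \<open>Separating the four powers from their formal derivatives reduces the claim to a polynomial identity.\<close>
  define f f' where "f = lin_x u ^ p1" and "f' = of_nat p1 * lin_x u ^ (p1 - 1)"
  define g g' where "g = lin_y u ^ q1" and "g' = of_nat q1 * lin_y u ^ (q1 - 1)"
  define h h' where "h = lin_x w ^ p2" and "h' = of_nat p2 * lin_x w ^ (p2 - 1)"
  define k k' where "k = lin_y w ^ q2" and "k' = of_nat q2 * lin_y w ^ (q2 - 1)"
  have x: "pdiff X1 f = f'" "pdiff X1 h = h'" "pdiff X2 f = Const u * f'" "pdiff X2 h = Const w * h'"
    by (simp_all add: f_def f'_def h_def h'_def pdiff.power mult.commute)
  have y: "pdiff Y1 g = g'" "pdiff Y1 k = k'" "pdiff Y2 g = Const u * g'" "pdiff Y2 k = Const w * k'"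
    by (simp_all add: g_def g'_def k_def k'_def pdiff.power mult.commute)
  have 0: "pdiff Y1 f = 0" "pdiff Y2 f = 0" "pdiff Y1 h = 0" "pdiff Y2 h = 0"
    "pdiff X1 g = 0" "pdiff X2 g = 0" "pdiff X1 k = 0" "pdiff X2 k = 0"
    "pdiff X1 g' = 0" "pdiff X2 g' = 0" "pdiff X1 k' = 0" "pdiff X2 k' = 0"
    by (simp_all add: f_def g_def h_def k_def g'_def k'_def pdiff.power pdiff_mult)
  have "Omega (f * g * h * k) =
      (f' * h + f * h') * (Const u * g' * k + Const w * g * k') -
      (Const u * f' * h + Const w * f * h') * (g' * k + g * k')"
    by (simp add: Omega_def pdiff_mult pdiff_add x y 0 distrib_left distrib_right mult_ac)
  also have "\<dots> = (Const w - Const u) * (f' * g * h * k') + (Const w - Const u) * - (f * g' * h' * k)"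
    by (simp add: distrib_left distrib_right left_diff_distrib right_diff_distrib mult_ac)
  finally show ?thesis
    by (simp add: lin_product_def f_def f'_def g_def g'_def h_def h'_def k_def k'_def
        Const_mult Const_diff Const_uminus Const_of_nat mult_ac)
qed

lemma on_diagonal_lin_product:
  "on_diagonal (lin_product u w p1 q1 p2 q2) = lin_x u ^ (p1 + q1) * lin_x w ^ (p2 + q2)"
  by (simp add: lin_product_def on_diagonal_mult on_diagonal_power power_add mult_ac)

lemma Omega_funpow_lin_product:
  "(Omega ^^ v) (lin_product u w p1 q1 p2 q2) = (\<Sum>t\<le>v.
     Const (of_nat (v choose t) * ((w - u) ^ v * (- 1) ^ (v - t) *
       of_nat (ffact p1 t * ffact q1 (v - t) * ffact p2 (v - t) * ffact q2 t))) *
     lin_product u w (p1 - t) (q1 - (v - t)) (p2 - (v - t)) (q2 - t))"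
proof -
  define F where "F k l = Const ((w - u) ^ (k + l) * (- 1) ^ l *
      of_nat (ffact p1 k * ffact q1 l * ffact p2 l * ffact q2 k)) *
      lin_product u w (p1 - k) (q1 - l) (p2 - l) (q2 - k)" for k l
  have "Omega (F k l) = F (Suc k) l + F k (Suc l)" for k l
    unfolding F_def Omega_Const_mult Omega_lin_product distrib_left mult.assoc [symmetric]
      Const_mult [symmetric]
    by (intro arg_cong2 [of _ _ _ _ "(+)"] arg_cong2 [of _ _ _ _ "(*) :: mpol \<Rightarrow> _"]
        arg_cong [of _ _ Const])
      (simp_all add: ffact_Suc mult_ac)
  then have "(Omega ^^ v) (F 0 0) = (\<Sum>t\<le>v. of_nat (v choose t) * F t (v - t))"
    by (intro funpow_binomial Omega_add)
  then show ?thesis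
    by (simp add: F_def Const_mult Const_of_nat mult.assoc)
qed

text \<open>
  The coefficient \<open>\<nu>\<close> with the sum extended over all \<open>t \<le> v\<close>.
\<close>

definition omega_coeff :: "nat \<Rightarrow> nat \<Rightarrow> nat \<Rightarrow> nat \<Rightarrow> nat \<Rightarrow> complex" where
  "omega_coeff p1 q1 p2 q2 v = (\<Sum>t\<le>v. (- 1) ^ (v - t) * of_nat (v choose t) *
     of_nat (ffact p1 t * ffact q1 (v - t) * ffact p2 (v - t) * ffact q2 t))"

lemma omega_coeff_eq_nu: "omega_coeff p1 q1 p2 q2 v = nu_coef p1 q1 p2 q2 v"
proof -
  let ?f = "\<lambda>t. (- 1) ^ (v - t) * of_nat (v choose t) *
     (of_nat (ffact p1 t * ffact q1 (v - t) * ffact p2 (v - t) * ffact q2 t) :: complex)"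
  have "?f t = 0" if "t \<in> {..v} - {v - min q1 p2..min p1 (min q2 v)}" for t
  proof -
    have "p1 < t \<or> q2 < t \<or> q1 < v - t \<or> p2 < v - t"
      using that by auto
    then show ?thesis by (auto simp: ffact_eq_0)
  qed
  then have "omega_coeff p1 q1 p2 q2 v = sum ?f {v - min q1 p2..min p1 (min q2 v)}"
    unfolding omega_coeff_def
    by (intro sum.mono_neutral_right ballI finite_atMost subsetI) (assumption | simp)+
  also have "\<dots> = nu_coef p1 q1 p2 q2 v"
    unfolding nu_coef_def
  proof (intro sum.cong refl)
    fix t assume "t \<in> {v - min q1 p2..min p1 (min q2 v)}"
    then have t: "t \<le> v" "t \<le> p1" "t \<le> q2" "v - t \<le> q1" "v - t \<le> p2" by auto
    then have "q1 - (v - t) = q1 + t - v" "p2 - (v - t) = p2 + t - v" by auto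
    moreover have "of_nat (v choose t) = (fact v / (fact t * fact (v - t)) :: complex)"
      using t by (simp add: binomial_fact)
    ultimately show "?f t = (- 1) ^ (v - t) * (fact v / (fact t * fact (v - t))) *
        (fact p1 / fact (p1 - t)) * (fact q1 / fact (q1 + t - v)) *
        (fact p2 / fact (p2 + t - v)) * (fact q2 / fact (q2 - t))"
      by (simp only: of_nat_mult of_nat_ffact t mult.assoc)
  qed
  finally show ?thesis .
qed

lemma omega_coeff_eq_0:
  assumes "p1 + q1 < v \<or> p2 + q2 < v"
  shows "omega_coeff p1 q1 p2 q2 v = 0"
  unfolding omega_coeff_def
proof (intro sum.neutral ballI)
  fix t assume "t \<in> {..v}"
  with assms have "p1 < t \<or> q2 < t \<or> q1 < v - t \<or> p2 < v - t" by auto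
  then show "(- 1) ^ (v - t) * of_nat (v choose t) *
     (of_nat (ffact p1 t * ffact q1 (v - t) * ffact p2 (v - t) * ffact q2 t) :: complex) = 0"
    by (auto simp: ffact_eq_0)
qed

text \<open>
  On the diagonal all terms of \<open>\<Omega>\<^sup>v\<close> collapse to the same product of powers. Exponents that would be
  negative occur only together with a vanishing falling factorial.
\<close>

lemma on_diagonal_Omega_funpow_lin_product:
  "on_diagonal ((Omega ^^ v) (lin_product u w p1 q1 p2 q2)) =
    Const ((w - u) ^ v * omega_coeff p1 q1 p2 q2 v) *
    (lin_x u ^ (p1 + q1 - v) * lin_x w ^ (p2 + q2 - v))"
proof -
  let ?c = "\<lambda>t. of_nat (v choose t) * ((w - u) ^ v * (- 1) ^ (v - t) *
      of_nat (ffact p1 t * ffact q1 (v - t) * ffact p2 (v - t) * ffact q2 t))"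
  let ?l = "lin_x u ^ (p1 + q1 - v) * lin_x w ^ (p2 + q2 - v)"
  have "on_diagonal ((Omega ^^ v) (lin_product u w p1 q1 p2 q2)) = (\<Sum>t\<le>v. Const (?c t) *
      (lin_x u ^ (p1 - t + (q1 - (v - t))) * lin_x w ^ (p2 - (v - t) + (q2 - t))))"
    unfolding Omega_funpow_lin_product
    by (simp add: on_diagonal_sum on_diagonal_mult on_diagonal_lin_product)
  also have "\<dots> = (\<Sum>t\<le>v. Const (?c t) * ?l)"
  proof (intro sum.cong refl)
    fix t assume t: "t \<in> {..v}"
    show "Const (?c t) * (lin_x u ^ (p1 - t + (q1 - (v - t))) *
        lin_x w ^ (p2 - (v - t) + (q2 - t))) = Const (?c t) * ?l"
    proof (cases "t \<le> p1 \<and> v - t \<le> q1 \<and> v - t \<le> p2 \<and> t \<le> q2")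
      case True
      with t have "p1 - t + (q1 - (v - t)) = p1 + q1 - v" "p2 - (v - t) + (q2 - t) = p2 + q2 - v"
        by auto
      then show ?thesis by simp
    next
      case False
      then have "?c t = 0" by (auto simp: ffact_eq_0 not_le)
      then show ?thesis by (simp only: Const_0 mult_zero_left)
    qed
  qed
  also have "\<dots> = Const (\<Sum>t\<le>v. ?c t) * ?l"
    by (simp only: Const_sum sum_distrib_right)
  also have "(\<Sum>t\<le>v. ?c t) = (w - u) ^ v * omega_coeff p1 q1 p2 q2 v"
    by (simp add: omega_coeff_def sum_distrib_left mult_ac)
  finally show ?thesis .
qed

section \<open>Transvectants\<close>

text \<open>
  The transvectant without its normalizing factor, in either pair of variables.
\<close>

definition transvection :: "var \<Rightarrow> var \<Rightarrow> nat \<Rightarrow> mpol \<Rightarrow> mpol \<Rightarrow> mpol" where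
  "transvection v w r A B = (\<Sum>i\<le>r. Const ((- 1) ^ i * of_nat (r choose i)) *
     (pdiff v ^^ (r - i)) ((pdiff w ^^ i) A) * (pdiff v ^^ i) ((pdiff w ^^ (r - i)) B))"

lemma transvectant_eq:
  "r \<le> min m n \<Longrightarrow> transvectant m n r A B =
    Const (fact (m - r) * fact (n - r) / (fact m * fact n)) * transvection X1 X2 r A B"
  by (auto simp: transvectant_def transvection_def min_less_iff_disj)

lemma transvection_commute: "transvection v w r A B = Const ((- 1) ^ r) * transvection v w r B A"
  unfolding transvection_def sum_distrib_left
proof (rule sum.reindex_bij_witness [of _ "\<lambda>i. r - i" "\<lambda>i. r - i"])
  fix i assume i: "i \<in> {..r}"
  have "(- 1) ^ r * (- 1) ^ (r - i) = ((- 1) ^ i :: complex)"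
    using i by (simp add: power_add [symmetric] minus_one_power_iff)
  then have "(- 1) ^ i * of_nat (r choose i) =
      (- 1) ^ r * ((- 1) ^ (r - i) * of_nat (r choose (r - i)) :: complex)"
    using i by (simp add: binomial_symmetric [of i r] mult.assoc [symmetric])
  then show "Const ((- 1) ^ r) * (Const ((- 1) ^ (r - i) * of_nat (r choose (r - i))) *
       (pdiff v ^^ (r - (r - i))) ((pdiff w ^^ (r - i)) B) *
       (pdiff v ^^ (r - i)) ((pdiff w ^^ (r - (r - i))) A)) =
      Const ((- 1) ^ i * of_nat (r choose i)) *
       (pdiff v ^^ (r - i)) ((pdiff w ^^ i) A) * (pdiff v ^^ i) ((pdiff w ^^ (r - i)) B)"
    using i by (simp only: Const_mult) (simp add: mult_ac)
qed auto

lemma pdiff_funpow_commute: "pdiff w ((pdiff v ^^ k) p) = (pdiff v ^^ k) (pdiff w p)"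
  by (induction k) (simp_all add: pdiff_commute [of w v])

lemma pdiff_funpow_add: "(pdiff v ^^ k) (p + q) = (pdiff v ^^ k) p + (pdiff v ^^ k) q"
  by (induction k) (simp_all add: pdiff_add)

lemma pdiff_funpow_0: "(pdiff v ^^ k) 0 = 0"
  by (induction k) simp_all

lemma pdiff_transvection:
  "pdiff x (transvection v w r A B) =
    transvection v w r (pdiff x A) B + transvection v w r A (pdiff x B)"
  by (simp add: transvection_def pdiff.sum pdiff_mult pdiff_funpow_commute sum.distrib [symmetric]
      algebra_simps)

lemma transvection_add_left:
  "transvection v w r (A + A') B = transvection v w r A B + transvection v w r A' B"
  by (simp add: transvection_def pdiff_funpow_add sum.distrib [symmetric] algebra_simps)

lemma transvection_mult_left:
  assumes "pdiff v c = 0" and "pdiff w c = 0"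
  shows "transvection v w r (c * A) B = c * transvection v w r A B"
  unfolding transvection_def sum_distrib_left pdiff.funpow_const_mult [OF assms(1)]
    pdiff.funpow_const_mult [OF assms(2)]
  by (simp only: mult_ac)

lemma transvection_sum_left:
  "transvection v w r (sum f I) B = (\<Sum>i\<in>I. transvection v w r (f i) B)"
proof (induction I rule: infinite_finite_induct)
  case empty
  show ?case using transvection_mult_left [of v 0 w r 0 B] by simp
qed (simp_all add: transvection_add_left transvection_mult_left [of v 0 w r 0 B, simplified])

lemma transvection_add_right:
  "transvection v w r A (B + B') = transvection v w r A B + transvection v w r A B'"
  by (simp add: transvection_def pdiff_funpow_add sum.distrib [symmetric] algebra_simps)

lemma transvection_mult_right:
  assumes "pdiff v c = 0" and "pdiff w c = 0"
  shows "transvection v w r A (c * B) = c * transvection v w r A B"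
  unfolding transvection_def sum_distrib_left pdiff.funpow_const_mult [OF assms(1)]
    pdiff.funpow_const_mult [OF assms(2)]
  by (simp only: mult_ac)

text \<open>
  Iterating the chain rule needs the intermediate derivatives to be free of \<open>\<^bold>y\<close> as well, which follows
  because partial derivatives commute.
\<close>

lemma in_y_transvection:
  assumes "pdiff Y1 A = 0" "pdiff Y2 A = 0" "pdiff Y1 B = 0" "pdiff Y2 B = 0"
  shows "in_y (transvection X1 X2 r A B) = transvection Y1 Y2 r (in_y A) (in_y B)"
proof -
  have step: "in_y ((pdiff X1 ^^ k) ((pdiff X2 ^^ l) p)) = (pdiff Y1 ^^ k) ((pdiff Y2 ^^ l) (in_y p))"
    if p: "pdiff Y1 p = 0" "pdiff Y2 p = 0" for k l p
  proof -
    have 2: "in_y ((pdiff X2 ^^ l) p) = (pdiff Y2 ^^ l) (in_y p)"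
    proof (induction l)
      case (Suc l)
      have "pdiff Y2 ((pdiff X2 ^^ l) p) = 0"
        by (simp add: pdiff_funpow_commute p pdiff_funpow_0)
      with Suc show ?case
        using pdiff_in_y(2) [of "(pdiff X2 ^^ l) p"] by (simp add: in_y_eq)
    qed simp
    show ?thesis
    proof (induction k)
      case (Suc k)
      have "pdiff Y1 ((pdiff X1 ^^ k) ((pdiff X2 ^^ l) p)) = 0"
        by (simp add: pdiff_funpow_commute p pdiff_funpow_0)
      with Suc show ?case
        using pdiff_in_y(1) [of "(pdiff X1 ^^ k) ((pdiff X2 ^^ l) p)"] by (simp add: in_y_eq)
    qed (simp add: 2)
  qed
  have "in_y (sum f I) = (\<Sum>i\<in>I. in_y (f i))" "in_y (p * q) = in_y p * in_y q"
    "in_y (Const c) = Const c" for f and I :: "nat set" and p q c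
    by (simp_all add: in_y_eq substitute_sum substitute_mult)
  with assms show ?thesis
    by (simp add: transvection_def step)
qed

lemma ffact_add: "ffact n (j + k) = ffact n j * ffact (n - j) k"
  by (induction k) (simp_all add: ffact_Suc)

abbreviation directional :: "var \<Rightarrow> var \<Rightarrow> complex \<Rightarrow> mpol \<Rightarrow> mpol" where
  "directional v w c \<equiv> \<lambda>p. Const c * pdiff v p + Const (- 1) * pdiff w p"

interpretation directional: derivation "directional v w c" for v w c
  by (intro derivation_combination pdiff.derivation_axioms)

text \<open>
  All derivatives of order \<open>r\<close> of \<open>f\<^sup>q\<close> are multiples of the same power \<open>f\<^bsup>q-r\<^esup>\<close>, and the sum that is left is
  the binomial expansion of a directional derivative.
\<close>

lemma transvection_power_right:
  assumes f: "pdiff v f = 1" "pdiff w f = Const c"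
  shows "transvection v w r A (f ^ q) =
    Const (of_nat (ffact q r)) * f ^ (q - r) * (directional v w c ^^ r) A"
proof -
  have power: "(pdiff v ^^ i) ((pdiff w ^^ (r - i)) (f ^ q)) =
      Const (of_nat (ffact q r) * c ^ (r - i)) * f ^ (q - r)" if "i \<le> r" for i
  proof -
    have "(pdiff w ^^ (r - i)) (f ^ q) =
        Const (of_nat (ffact q (r - i)) * c ^ (r - i)) * f ^ (q - (r - i))"
      by (simp add: pdiff.funpow_power f Const_mult Const_of_nat Const_power)
    then have "(pdiff v ^^ i) ((pdiff w ^^ (r - i)) (f ^ q)) =
        Const (of_nat (ffact q (r - i)) * c ^ (r - i)) *
        (of_nat (ffact (q - (r - i)) i) * f ^ (q - (r - i) - i))"
      by (simp add: pdiff.funpow_const_mult pdiff.funpow_power f)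
    moreover have "ffact q r = ffact q (r - i) * ffact (q - (r - i)) i"
      using ffact_add [of q "r - i" i] that by simp
    moreover have "q - (r - i) - i = q - r" using that by simp
    ultimately show ?thesis
      by (simp add: Const_mult Const_of_nat mult_ac)
  qed
  define F where "F k l = Const (c ^ k * (- 1) ^ l) * (pdiff v ^^ k) ((pdiff w ^^ l) A)" for k l
  have "directional v w c (F k l) = F (Suc k) l + F k (Suc l)" for k l
    by (simp add: F_def pdiff_mult Const_mult Const_uminus pdiff_funpow_commute [where w = w and v = v]
        distrib_left mult_ac)
  then have "(directional v w c ^^ r) (F 0 0) = (\<Sum>k\<le>r. of_nat (r choose k) * F k (r - k))"
    by (intro funpow_binomial directional.add)
  also have "\<dots> = (\<Sum>i\<le>r. of_nat (r choose i) * F (r - i) i)"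
    by (rule sum.reindex_bij_witness [of _ "\<lambda>i. r - i" "\<lambda>i. r - i"])
      (auto simp: binomial_symmetric [symmetric])
  finally have D: "(directional v w c ^^ r) A = (\<Sum>i\<le>r. of_nat (r choose i) * F (r - i) i)"
    by (simp add: F_def)
  show ?thesis
    unfolding transvection_def D sum_distrib_left
    by (intro sum.cong refl) (simp add: power F_def Const_mult Const_of_nat mult_ac)
qed

lemma transvection_lin_x_powers:
  "transvection X1 X2 r (lin_x u ^ p) (lin_x w ^ q) =
    Const (of_nat (ffact p r) * of_nat (ffact q r) * (w - u) ^ r) *
    (lin_x u ^ (p - r) * lin_x w ^ (q - r))"
proof -
  have D: "directional X1 X2 w (lin_x u) = Const (w - u)"
    by (simp add: Const_diff Const_uminus)
  then have "(directional X1 X2 w ^^ r) (lin_x u ^ p) =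
      of_nat (ffact p r) * Const (w - u) ^ r * lin_x u ^ (p - r)"
    by (subst directional.funpow_power) (simp_all only: D directional.Const)
  then show ?thesis
    by (simp add: transvection_power_right Const_mult Const_of_nat Const_power mult_ac)
qed

lemma transvectant_lin_x_powers:
  "transvectant p q r (lin_x u ^ p) (lin_x w ^ q) =
    (if r \<le> min p q then Const ((w - u) ^ r) * (lin_x u ^ (p - r) * lin_x w ^ (q - r)) else 0)"
proof (cases "r \<le> min p q")
  case True
  then have r: "r \<le> p" "r \<le> q" by auto
  have "fact (p - r) * fact (q - r) / (fact p * fact q) *
      (of_nat (ffact p r) * of_nat (ffact q r) * (w - u) ^ r) = (w - u) ^ r"
    by (simp add: of_nat_ffact r)
  then show ?thesis
    using True by (simp add: transvectant_eq transvection_lin_x_powers mult.assoc [symmetric]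
        Const_mult [symmetric] del: min_less_iff_conj)
qed (auto simp: transvectant_def min_less_iff_disj)

section \<open>Evectants of a transvectant\<close>

lemma pochhammer_of_nat_eq_fact: "pochhammer (of_nat m + 1) i = (fact (m + i) / fact m :: complex)"
proof -
  have "pochhammer (of_nat m + 1) i * fact m = (fact (m + i) :: complex)"
  proof (induction i)
    case (Suc i)
    have "pochhammer (of_nat m + 1) (Suc i) * fact m =
        (of_nat m + 1 + of_nat i) * (pochhammer (of_nat m + 1) i * fact m :: complex)"
      by (simp only: pochhammer_Suc mult_ac)
    also have "\<dots> = fact (m + Suc i)"
      unfolding Suc.IH by (simp add: add_ac)
    finally show ?case .
  qed simp
  then show ?thesis by (simp add: eq_divide_eq)
qed

text \<open>
  \<open>\<mu>\<close> is the constant of \<open>Omega_funpow_bracket_power_mult\<close> for a form of total degree \<open>p + q\<close>. The bound on \<open>l\<close>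
  keeps the subtractions in \<^const>\<open>mu_coef\<close> from being truncated.
\<close>

lemma mu_coef_eq:
  assumes "i \<le> l" and "l \<le> p + q + i + 1"
  shows "mu_coef p q l i =
    of_nat (ffact l i) * pochhammer (of_nat (p + q) - of_nat l + of_nat i + 2) i"
proof -
  define m where "m = p + q + i + 1 - l"
  have "of_nat m = (of_nat (p + q + i + 1) - of_nat l :: complex)"
    unfolding m_def using assms(2) by (rule of_nat_diff)
  then have a: "of_nat (p + q) - of_nat l + of_nat i + 2 = (of_nat m + 1 :: complex)"
    by simp
  have b: "p + q + 2 * i + 1 - l = m + i"
    using assms by (simp add: m_def)
  show ?thesis
    unfolding mu_coef_def a b m_def [symmetric] pochhammer_of_nat_eq_fact of_nat_ffact [OF assms(1)] ..
qed

text \<open>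
  The part of \<open>\<xi>\<^sub>i\<close> and (with \<open>n\<close> and \<open>n'\<close> exchanged) of \<open>\<eta>\<^sub>i\<close> that depends on \<open>i\<close>.
\<close>

definition evectant_coeff :: "nat \<Rightarrow> nat \<Rightarrow> nat \<Rightarrow> nat \<Rightarrow> nat \<Rightarrow> nat \<Rightarrow> complex" where
  "evectant_coeff d n n' r s i = (\<Sum>k = max (r + i - n) (i - s)..min i r.
     lambda_coef r i k n n' *
     mu_coef (d + k - i) (n + n' + k - 2 * r - i) s (i - k) *
     nu_coef (d - i) (n + k - i - r) k (n' - r) (s + k - i))"

lemma Omega_funpow_sum: "(Omega ^^ s) (sum f I) = (\<Sum>i\<in>I. (Omega ^^ s) (f i))"
  by (induction I rule: infinite_finite_induct)
    (simp_all add: Omega_funpow_add Omega_funpow_0)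

text \<open>
  The Leibniz rule; the derivation maps \<open>(\<^bold>x \<^bold>y)\<close> to \<open>- b\<^sub>x\<close> and \<open>a\<^sub>y\<close> to \<open>(a b)\<close>, and both images are
  constants for it.
\<close>

lemma directional_bracket_power_mult:
  "(directional Y1 Y2 w ^^ r) (bracket_xy ^ i * (lin_x u ^ p * lin_y u ^ q)) =
    (\<Sum>k\<le>r. Const (of_nat (r choose k) * (- 1) ^ k * of_nat (ffact i k) * of_nat (ffact q (r - k)) *
        (w - u) ^ (r - k)) *
      (bracket_xy ^ (i - k) * (lin_x u ^ p * lin_y u ^ (q - (r - k)) * lin_x w ^ k)))"
proof -
  let ?D = "directional Y1 Y2 w"
  have b: "?D bracket_xy = - lin_x w"
    by (simp add: bracket_xy_def lin_x_def pdiff.diff pdiff_mult Const_uminus)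
  have "(?D ^^ k) (bracket_xy ^ i) = of_nat (ffact i k) * (- lin_x w) ^ k * bracket_xy ^ (i - k)" for k
    by (subst directional.funpow_power) (simp_all only: b, simp add: pdiff.uminus)
  then have 1: "(?D ^^ k) (bracket_xy ^ i) =
      Const ((- 1) ^ k * of_nat (ffact i k)) * (bracket_xy ^ (i - k) * lin_x w ^ k)" for k
    by (simp add: Const_mult Const_power Const_uminus Const_of_nat power_minus [of "lin_x w"] mult_ac)
  have y: "?D (lin_y u) = Const (w - u)"
    by (simp add: Const_diff Const_uminus)
  have x: "?D (lin_x u ^ p) = 0"
    by (simp add: pdiff.power)
  have "(?D ^^ j) (lin_y u ^ q) = of_nat (ffact q j) * Const (w - u) ^ j * lin_y u ^ (q - j)" for j
    by (subst directional.funpow_power) (simp_all only: y directional.Const)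
  then have 2: "(?D ^^ j) (lin_x u ^ p * lin_y u ^ q) =
      Const (of_nat (ffact q j) * (w - u) ^ j) * (lin_x u ^ p * lin_y u ^ (q - j))" for j
    by (simp only: directional.funpow_const_mult [OF x])
      (simp only: Const_mult Const_power Const_of_nat mult_ac)
  show ?thesis
    unfolding directional.leibniz [where p = "bracket_xy ^ i"] 1 2
    by (intro sum.cong refl) (simp only: Const_mult Const_of_nat mult_ac)
qed

text \<open>
  The identity that produces the coefficients: the index \<open>k\<close> counts how many of the \<open>r\<close> derivatives hit
  \<open>(\<^bold>x \<^bold>y)\<^sup>i\<close> in the Leibniz rule. Every \<open>k\<close> contributes the bracket factor \<open>(a b)\<close> to the power
  \<open>(r - k) + (s - (i - k)) = r + s - i\<close>, independently of \<open>k\<close>, and therefore a multiple of the same transvectant.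
\<close>

lemma omega_of_transvection_powers:
  assumes i: "i \<le> min d n" and r: "r \<le> min n n'" and s: "s \<le> min d (n + n' - 2 * r)"
  shows "on_diagonal ((Omega ^^ s) (transvection Y1 Y2 r
      (bracket_xy ^ i * (lin_x u ^ (d - i) * lin_y u ^ (n - i))) (lin_y w ^ n'))) =
    Const (evectant_coeff d n n' r s i) *
    transvectant (d + n - 2 * i) n' (r + s - i) (lin_x u ^ (d + n - 2 * i)) (lin_x w ^ n')"
proof -
  let ?T = "transvectant (d + n - 2 * i) n' (r + s - i) (lin_x u ^ (d + n - 2 * i)) (lin_x w ^ n')"
  define \<alpha> :: "nat \<Rightarrow> complex" where "\<alpha> k = of_nat (ffact n' r) * (of_nat (r choose k) * (- 1) ^ k *
      of_nat (ffact i k) * of_nat (ffact (n - i) (r - k)))" for k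
  define M where "M k = lin_product u w (d - i) (n - i - (r - k)) k (n' - r)" for k
  define \<mu> :: "nat \<Rightarrow> complex" where "\<mu> k = of_nat (ffact s (i - k)) *
      pochhammer (of_nat (d - i + (n - i - (r - k)) + k + (n' - r)) - of_nat s + of_nat (i - k) + 2)
        (i - k)" for k
  define \<gamma> where "\<gamma> k = lambda_coef r i k n n' *
      mu_coef (d + k - i) (n + n' + k - 2 * r - i) s (i - k) *
      nu_coef (d - i) (n + k - i - r) k (n' - r) (s + k - i)" for k
  let ?K = "{max (r + i - n) (i - s)..min i r}"
  have "transvection Y1 Y2 r (bracket_xy ^ i * (lin_x u ^ (d - i) * lin_y u ^ (n - i))) (lin_y w ^ n') =
      Const (of_nat (ffact n' r)) * lin_y w ^ (n' - r) *
      (directional Y1 Y2 w ^^ r) (bracket_xy ^ i * (lin_x u ^ (d - i) * lin_y u ^ (n - i)))"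
    by (rule transvection_power_right) simp_all
  also have "\<dots> = (\<Sum>k\<le>r. Const (\<alpha> k * (w - u) ^ (r - k)) * (bracket_xy ^ (i - k) * M k))"
    unfolding directional_bracket_power_mult sum_distrib_left \<alpha>_def M_def lin_product_def
    by (intro sum.cong refl) (simp only: Const_mult mult_ac)
  finally have "on_diagonal ((Omega ^^ s) (transvection Y1 Y2 r
      (bracket_xy ^ i * (lin_x u ^ (d - i) * lin_y u ^ (n - i))) (lin_y w ^ n'))) =
      (\<Sum>k\<le>r. Const (\<alpha> k * (w - u) ^ (r - k)) *
        on_diagonal ((Omega ^^ s) (bracket_xy ^ (i - k) * M k)))"
    by (simp only: Omega_funpow_sum Omega_funpow_Const_mult on_diagonal_sum on_diagonal_mult
        on_diagonal_Const)
  also have "\<dots> = (\<Sum>k\<le>r. Const (if k \<in> ?K then \<gamma> k else 0) * ?T)"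
  proof (intro sum.cong refl)
    fix k assume "k \<in> {..r}"
    then have k: "k \<le> r" by simp
    let ?v = "s - (i - k)" and ?p = "d - i + (n - i - (r - k))" and ?q = "k + (n' - r)"
    let ?\<omega> = "omega_coeff (d - i) (n - i - (r - k)) k (n' - r) ?v"
    have "Const (\<alpha> k * (w - u) ^ (r - k)) * on_diagonal ((Omega ^^ s) (bracket_xy ^ (i - k) * M k)) =
        Const (\<alpha> k * (w - u) ^ (r - k)) * (Const (\<mu> k) * (Const ((w - u) ^ ?v * ?\<omega>) *
          (lin_x u ^ (?p - ?v) * lin_x w ^ (?q - ?v))))"
      unfolding M_def \<mu>_def
        Omega_funpow_bracket_power_mult [OF euler_lin_product] on_diagonal_Omega_funpow_lin_product ..
    also have "\<dots> = Const (\<alpha> k * \<mu> k * ?\<omega>) *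
        (Const ((w - u) ^ (r - k + ?v)) * (lin_x u ^ (?p - ?v) * lin_x w ^ (?q - ?v)))"
      by (simp only: Const_mult power_add mult_ac)
    also have "\<dots> = Const (if k \<in> ?K then \<gamma> k else 0) * ?T"
    proof (cases "k \<in> ?K")
      case True
      then have k': "k \<le> i" "r - k \<le> n - i" "i - k \<le> s"
        using i k by auto
      have "n - i - (r - k) = n + k - i - r" and v: "?v = s + k - i"
        using i k k' by auto
      then have \<omega>: "?\<omega> = nu_coef (d - i) (n + k - i - r) k (n' - r) (s + k - i)"
        by (simp only: omega_coeff_eq_nu)
      have "of_nat (r choose k) = (fact r / (fact k * fact (r - k)) :: complex)"
        using k by (rule binomial_fact)
      moreover have "n - i - (r - k) = n + k - i - r" "r \<le> n'" using i k k' r by auto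
      ultimately have \<lambda>: "\<alpha> k = lambda_coef r i k n n'"
        by (simp only: \<alpha>_def lambda_coef_def of_nat_ffact k' mult_ac)
      have "d - i + (n - i - (r - k)) + k + (n' - r) = (d + k - i) + (n + n' + k - 2 * r - i)"
        using i r k k' by auto
      moreover have "s \<le> (d + k - i) + (n + n' + k - 2 * r - i) + (i - k) + 1"
        using i r s k k' by auto
      ultimately have \<mu>: "\<mu> k = mu_coef (d + k - i) (n + n' + k - 2 * r - i) s (i - k)"
        unfolding \<mu>_def using mu_coef_eq [OF k'(3)] by simp
      have c: "\<alpha> k * \<mu> k * ?\<omega> = \<gamma> k"
        by (simp only: \<gamma>_def \<omega> \<mu> \<lambda>)
      \<comment> \<open>A transvectant of too high an index is \<open>0\<close> by convention; there \<open>\<nu>\<close> vanishes as well.\<close>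
      show ?thesis
      proof (cases "r + s - i \<le> min (d + n - 2 * i) n'")
        case R: True
        have "r - k + ?v = r + s - i" "?p - ?v = d + n - 2 * i - (r + s - i)"
          "?q - ?v = n' - (r + s - i)"
          using i r s k k' R by auto
        then show ?thesis
          using True R by (simp only: c transvectant_lin_x_powers if_True)
      next
        case False
        then have "d + n < r + s + i \<or> n' + i < r + s"
          using i by auto
        moreover have "?p + i + i + r = d + n + k" "?v + i = s + k" "?q + r = n' + k"
          using i r k k' by auto
        ultimately have "?p < ?v \<or> ?q < ?v"
          by linarith
        then have "?\<omega> = 0" by (rule omega_coeff_eq_0)
        then show ?thesis
          using False by (simp only: transvectant_lin_x_powers if_False mult_zero_left mult_zero_right Const_0)
      qed
    next
      case False
      then have "i < k \<or> n - i < r - k \<or> s < i - k"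
        using i k by auto
      then have "\<alpha> k * \<mu> k = 0"
        by (auto simp: \<alpha>_def \<mu>_def ffact_eq_0)
      then show ?thesis
        using False by (simp only: if_False Const_0 mult_zero_left)
    qed
    finally show "Const (\<alpha> k * (w - u) ^ (r - k)) *
        on_diagonal ((Omega ^^ s) (bracket_xy ^ (i - k) * M k)) =
      Const (if k \<in> ?K then \<gamma> k else 0) * ?T" .
  qed
  also have "\<dots> = Const (\<Sum>k\<le>r. if k \<in> ?K then \<gamma> k else 0) * ?T"
    by (simp only: Const_sum sum_distrib_right)
  also have "(\<Sum>k\<le>r. if k \<in> ?K then \<gamma> k else 0) = sum \<gamma> ({..r} \<inter> ?K)"
    by (rule sum.inter_restrict [symmetric]) simp
  also have "{..r} \<inter> ?K = ?K" by auto
  also have "sum \<gamma> ?K = evectant_coeff d n n' r s i"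
    unfolding evectant_coeff_def by (intro sum.cong refl \<gamma>_def)
  finally show ?thesis .
qed

lemma scalar_linear_transvection_left:
  assumes "v \<in> {X1, X2, Y1, Y2}" and "w \<in> {X1, X2, Y1, Y2}"
  shows "scalar_linear (\<lambda>A. transvection v w r A B)"
  unfolding scalar_linear_def
  by (intro conjI allI impI transvection_add_left transvection_mult_left pdiff_scalar assms)

lemma scalar_linear_transvection_right:
  assumes "v \<in> {X1, X2, Y1, Y2}" and "w \<in> {X1, X2, Y1, Y2}"
  shows "scalar_linear (transvection v w r A)"
  unfolding scalar_linear_def
  by (intro conjI allI impI transvection_add_right transvection_mult_right pdiff_scalar assms)

lemma scalar_linear_transvectant:
  "scalar_linear (\<lambda>A. transvectant m n r A B)" "scalar_linear (transvectant m n r A)"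
proof -
  have eq: "transvectant m n r A B = (if r \<le> min m n
      then Const (fact (m - r) * fact (n - r) / (fact m * fact n)) else 0) * transvection X1 X2 r A B"
    for A B
    by (auto simp: transvectant_eq) (auto simp: transvectant_def min_less_iff_disj)
  show "scalar_linear (\<lambda>A. transvectant m n r A B)" "scalar_linear (transvectant m n r A)"
    unfolding eq [abs_def]
    by (intro scalar_linear_mult scalar_linear_transvection_left scalar_linear_transvection_right; simp)+
qed

lemma scalar_linear_polarization: "scalar_linear (polarization d n i)"
  unfolding polarization_def [abs_def]
  by (intro scalar_linear_mult scalar_linear_funpow scalar_linear_add scalar_linear_pdiff) simp_all

lemma scalar_linear_omega: "scalar_linear (\<lambda>p. on_diagonal ((Omega ^^ s) p))"
proof -
  have "scalar_linear Omega"
    unfolding Omega_def [abs_def]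
    by (rule scalar_linear_diff
        [OF scalar_linear_comp [OF scalar_linear_pdiff [of X1] scalar_linear_pdiff [of Y2]]
          scalar_linear_comp [OF scalar_linear_pdiff [of X2] scalar_linear_pdiff [of Y1]]]) simp_all
  moreover have "scalar_linear on_diagonal"
    unfolding on_diagonal_def by (rule scalar_linear_substitute) simp
  ultimately show ?thesis
    by (rule scalar_linear_comp [OF _ scalar_linear_funpow, rotated])
qed

lemma scalar_linear_in_y: "scalar_linear in_y"
  unfolding in_y_eq by (rule scalar_linear_substitute) simp

text \<open>
  The normalizing factor of the polarization is chosen such that \<open>a\<^sub>x\<^bsup>d+n-2i\<^esup>\<close> becomes \<open>a\<^sub>x\<^bsup>d-i\<^esup> a\<^sub>y\<^bsup>n-i\<^esup>\<close>.
\<close>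

lemma polarization_lin_x_power:
  assumes "i \<le> min d n"
  shows "polarization d n i (lin_x u ^ (d + n - 2 * i)) = lin_x u ^ (d - i) * lin_y u ^ (n - i)"
proof -
  let ?D = "\<lambda>p. Var Y1 * pdiff X1 p + Var Y2 * pdiff X2 p"
  interpret D: derivation ?D
    by (intro derivation_combination pdiff.derivation_axioms)
  have lin: "?D (lin_x u) = lin_y u" "?D (lin_y u) = 0"
    by (simp_all only: pdiff_lin) (simp_all add: lin_y_def mult.commute)
  let ?N = "d + n - 2 * i"
  have N: "n - i \<le> ?N" "?N - (n - i) = d - i"
    using assms by auto
  have "(?D ^^ (n - i)) (lin_x u ^ ?N) =
      of_nat (ffact ?N (n - i)) * lin_y u ^ (n - i) * lin_x u ^ (d - i)"
    by (subst D.funpow_power) (simp_all only: lin N)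
  moreover have "fact (d - i) / fact ?N * of_nat (ffact ?N (n - i)) = (1 :: complex)"
    using N by (simp add: of_nat_ffact)
  then have "Const (fact (d - i) / fact ?N) * of_nat (ffact ?N (n - i)) = 1"
    by (simp only: Const_mult [symmetric] Const_of_nat [symmetric] Const_1)
  ultimately show ?thesis
    unfolding polarization_def by (simp only: mult.assoc [symmetric] mult_1_left) (rule mult.commute)
qed

lemma in_y_lin_x_power: "in_y (lin_x u ^ k) = lin_y u ^ k"
  by (simp add: in_y_eq substitute_power lin_x_def lin_y_def substitute_add substitute_mult)

text \<open>
  Both sides are linear in \<open>A\<close> and in \<open>\<Psi>\<close>, so the case of powers of linear forms implies the general one.
\<close>

lemma omega_of_transvection:
  assumes i: "i \<le> min d n" and r: "r \<le> min n n'" and s: "s \<le> min d (n + n' - 2 * r)"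
    and A: "is_form e (d + n - 2 * i) A" and \<Psi>: "is_form e' n' \<Psi>"
  shows "on_diagonal ((Omega ^^ s)
      (transvection Y1 Y2 r (bracket_xy ^ i * polarization d n i A) (in_y \<Psi>))) =
    Const (evectant_coeff d n n' r s i) * transvectant (d + n - 2 * i) n' (r + s - i) A \<Psi>"
proof -
  define L where "L A \<Psi> = on_diagonal ((Omega ^^ s)
      (transvection Y1 Y2 r (bracket_xy ^ i * polarization d n i A) (in_y \<Psi>)))" for A \<Psi>
  define L' where "L' A \<Psi> = Const (evectant_coeff d n n' r s i) *
      transvectant (d + n - 2 * i) n' (r + s - i) A \<Psi>" for A \<Psi>
  have left: "scalar_linear (\<lambda>A. L A \<Psi>)" for \<Psi>
  proof -
    have "scalar_linear (\<lambda>A. transvection Y1 Y2 r (bracket_xy ^ i * polarization d n i A) (in_y \<Psi>))"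
      by (rule scalar_linear_comp [OF scalar_linear_transvection_left
            scalar_linear_mult [OF scalar_linear_polarization]]) simp_all
    then show ?thesis
      unfolding L_def by (rule scalar_linear_comp [OF scalar_linear_omega])
  qed
  have right: "scalar_linear (L A)" for A
  proof -
    have "scalar_linear (\<lambda>\<Psi>. transvection Y1 Y2 r (bracket_xy ^ i * polarization d n i A) (in_y \<Psi>))"
      by (rule scalar_linear_comp [OF scalar_linear_transvection_right scalar_linear_in_y]) simp_all
    then show ?thesis
      unfolding L_def [abs_def] by (rule scalar_linear_comp [OF scalar_linear_omega])
  qed
  have left': "scalar_linear (\<lambda>A. L' A \<Psi>)" and right': "scalar_linear (L' A)" for A \<Psi>
    unfolding L'_def [abs_def] by (rule scalar_linear_mult, rule scalar_linear_transvectant)+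
  have "L (lin_x u ^ (d + n - 2 * i)) (lin_x w ^ n') = L' (lin_x u ^ (d + n - 2 * i)) (lin_x w ^ n')"
    for u w
    unfolding L_def L'_def polarization_lin_x_power [OF i] in_y_lin_x_power
    by (rule omega_of_transvection_powers [OF i r s])
  from scalar_linear_form_eqI [OF right right' this \<Psi>]
  have "L (lin_x u ^ (d + n - 2 * i)) \<Psi> = L' (lin_x u ^ (d + n - 2 * i)) \<Psi>" for u .
  from scalar_linear_form_eqI [OF left left' this A]
  show ?thesis by (simp only: L_def L'_def)
qed

text \<open>
  Selection of one term of a Gordan series. For \<open>i < s\<close> some \<open>\<Omega>\<close> is left to act on a polarization, which is
  annihilated; for \<open>i > s\<close> a factor \<open>(\<^bold>x \<^bold>y)\<close> survives and vanishes on the diagonal.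
\<close>

lemma omega_of_gordan_term:
  assumes i: "i \<le> min d n" and s: "s \<le> min d n" and C: "is_form e (d + n - 2 * i) C"
  shows "on_diagonal ((Omega ^^ s) (bracket_xy ^ i * polarization d n i C)) =
    Const (if i = s then mu_coef (d - s) (n - s) s s else 0) * C"
proof -
  define L where "L C = on_diagonal ((Omega ^^ s) (bracket_xy ^ i * polarization d n i C))" for C
  define L' where "L' C = Const (if i = s then mu_coef (d - s) (n - s) s s else 0) * C" for C
  have L: "scalar_linear L"
    unfolding L_def [abs_def]
    by (rule scalar_linear_comp [OF scalar_linear_omega
          scalar_linear_mult [OF scalar_linear_polarization]])
  have L': "scalar_linear L'"
    unfolding L'_def [abs_def] by (rule scalar_linear_mult [OF scalar_linear_id])
  have "L (lin_x u ^ (d + n - 2 * i)) = L' (lin_x u ^ (d + n - 2 * i))" for u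
  proof -
    \<comment> \<open>With exponents \<open>0\<close> for the second linear form, its parameter is arbitrary and set to \<open>0\<close>.\<close>
    have "bracket_xy ^ i * polarization d n i (lin_x u ^ (d + n - 2 * i)) =
        bracket_xy ^ i * lin_product u 0 (d - i) (n - i) 0 0"
      by (simp add: polarization_lin_x_power [OF i] lin_product_def)
    then have omega: "on_diagonal ((Omega ^^ s)
        (bracket_xy ^ i * polarization d n i (lin_x u ^ (d + n - 2 * i)))) =
      Const (of_nat (ffact s i) *
          pochhammer (of_nat (d - i + (n - i) + 0 + 0) - of_nat s + of_nat i + 2) i) *
        (Const ((0 - u) ^ (s - i) * omega_coeff (d - i) (n - i) 0 0 (s - i)) *
          (lin_x u ^ (d - i + (n - i) - (s - i)) * lin_x 0 ^ (0 + 0 - (s - i))))"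
      by (simp only: Omega_funpow_bracket_power_mult [OF euler_lin_product]
          on_diagonal_Omega_funpow_lin_product)
    show ?thesis
    proof (cases i s rule: linorder_cases)
      case less
      then have "omega_coeff (d - i) (n - i) 0 0 (s - i) = 0"
        by (intro omega_coeff_eq_0) simp
      with less show ?thesis
        unfolding L_def L'_def omega by simp
    next
      case equal
      have "mu_coef (d - s) (n - s) s s =
          of_nat (ffact s s) * pochhammer (of_nat (d - s + (n - s)) - of_nat s + of_nat s + 2) s"
        by (rule mu_coef_eq) simp_all
      moreover have "d - s + (n - s) = d + n - 2 * s"
        using s by auto
      ultimately show ?thesis
        unfolding L_def L'_def omega using equal by (simp add: omega_coeff_def)
    next
      case greater
      then show ?thesis
        unfolding L_def L'_def omega by (simp add: ffact_eq_0)
    qed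
  qed
  from scalar_linear_form_eqI [OF L L' this C]
  show ?thesis by (simp only: L_def L'_def)
qed

lemma pdiff_Y_form:
  assumes "is_form d n p"
  shows "pdiff Y1 p = 0" "pdiff Y2 p = 0"
proof -
  have "pdiff v p = 0" if "v = Y1 \<or> v = Y2" for v
    unfolding pdiff_def
  proof (intro sum.neutral ballI)
    fix t assume "t \<in> Poly_Mapping.keys p"
    then have "v \<notin> Poly_Mapping.keys t"
      using assms that by (auto simp: is_form_def)
    then show "Poly_Mapping.single (t - Poly_Mapping.single v 1)
        (of_nat (Poly_Mapping.lookup t v) * Poly_Mapping.lookup p t) = 0"
      by (simp add: in_keys_iff)
  qed
  then show "pdiff Y1 p = 0" "pdiff Y2 p = 0" by simp_all
qed

text \<open>
  The operator \<open>\<E>(\<^bold>x)\<close>.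
\<close>

definition evectant_operator :: "nat \<Rightarrow> mpol \<Rightarrow> mpol" where
  "evectant_operator d p = (\<Sum>i\<le>d. Var X1 ^ i * (- Var X2) ^ (d - i) * pdiff (Coef i) p)"

lemma evectant_operator_in_y:
  assumes "m \<ge> 1"
  shows "evectant_operator d (in_y \<Phi>) = Const (of_nat m) * Gamma_form d m \<Phi>"
proof -
  have "Const (of_nat m) * Const (1 / of_nat m) = 1"
    using assms by (simp add: Const_mult [symmetric] del: Const_1) simp
  then show ?thesis
    by (simp add: Gamma_form_def evectant_operator_def mult.assoc [symmetric])
qed

text \<open>
  \<open>\<E>(\<^bold>x)\<close> differentiates with respect to the \<open>a\<^sub>i\<close> and has coefficients in \<open>\<^bold>x\<close>, so it commutes with transvection in
  \<open>\<^bold>y\<close> and obeys the product rule. The sign comes from exchanging the arguments, by which both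
  summands take the same shape.
\<close>

lemma evectant_operator_transvection:
  "evectant_operator d (transvection Y1 Y2 r A B) =
    transvection Y1 Y2 r (evectant_operator d A) B +
    Const ((- 1) ^ r) * transvection Y1 Y2 r (evectant_operator d B) A"
proof -
  have c: "pdiff Y1 (Var X1 ^ i * (- Var X2) ^ j) = 0" "pdiff Y2 (Var X1 ^ i * (- Var X2) ^ j) = 0"
    for i j
    by (simp_all add: pdiff_mult pdiff.power pdiff.uminus)
  have left: "transvection Y1 Y2 r (evectant_operator d A) B =
      (\<Sum>i\<le>d. Var X1 ^ i * (- Var X2) ^ (d - i) * transvection Y1 Y2 r (pdiff (Coef i) A) B)" for A B
    unfolding evectant_operator_def transvection_sum_left
    by (simp only: transvection_mult_left [OF c])
  have "evectant_operator d (transvection Y1 Y2 r A B) =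
      (\<Sum>i\<le>d. Var X1 ^ i * (- Var X2) ^ (d - i) * transvection Y1 Y2 r (pdiff (Coef i) A) B) +
      (\<Sum>i\<le>d. Const ((- 1) ^ r) *
        (Var X1 ^ i * (- Var X2) ^ (d - i) * transvection Y1 Y2 r (pdiff (Coef i) B) A))"
    unfolding evectant_operator_def pdiff_transvection
      transvection_commute [of Y1 Y2 r A "pdiff _ B"] sum.distrib [symmetric]
    by (intro sum.cong refl) (simp only: distrib_left mult_ac)
  then show ?thesis
    by (simp only: left sum_distrib_left)
qed

lemma omega_of_transvection_evectants:
  assumes m: "m \<ge> 1" and \<A>: "are_evectants d m n \<Phi> \<A>" and \<Psi>: "is_form d n' \<Psi>"
    and r: "r \<le> min n n'" and s: "s \<le> min d (n + n' - 2 * r)"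
  shows "on_diagonal ((Omega ^^ s)
      (transvection Y1 Y2 r (evectant_operator d (in_y \<Phi>)) (in_y \<Psi>))) =
    Const (of_nat m) * (\<Sum>i\<le>min d n. Const (evectant_coeff d n n' r s i) *
      transvectant (d + n - 2 * i) n' (r + s - i) (\<A> i) \<Psi>)"
proof -
  have "evectant_operator d (in_y \<Phi>) =
      Const (of_nat m) * (\<Sum>i\<le>min d n. bracket_xy ^ i * polarization d n i (\<A> i))"
    using \<A> by (simp only: evectant_operator_in_y [OF m] are_evectants_def)
  then have "on_diagonal ((Omega ^^ s)
      (transvection Y1 Y2 r (evectant_operator d (in_y \<Phi>)) (in_y \<Psi>))) =
    Const (of_nat m) * (\<Sum>i\<le>min d n. on_diagonal ((Omega ^^ s)
      (transvection Y1 Y2 r (bracket_xy ^ i * polarization d n i (\<A> i)) (in_y \<Psi>))))"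
    by (simp only: transvection_mult_left pdiff_Const transvection_sum_left Omega_funpow_Const_mult
        Omega_funpow_sum on_diagonal_mult on_diagonal_Const on_diagonal_sum)
  also have "(\<Sum>i\<le>min d n. on_diagonal ((Omega ^^ s)
      (transvection Y1 Y2 r (bracket_xy ^ i * polarization d n i (\<A> i)) (in_y \<Psi>)))) =
    (\<Sum>i\<le>min d n. Const (evectant_coeff d n n' r s i) *
      transvectant (d + n - 2 * i) n' (r + s - i) (\<A> i) \<Psi>)"
  proof (intro sum.cong refl)
    fix i assume "i \<in> {..min d n}"
    then have i: "i \<le> min d n" by simp
    then have "is_form d (d + n - 2 * i) (\<A> i)"
      using \<A> by (simp add: are_evectants_def)
    with i show "on_diagonal ((Omega ^^ s)
        (transvection Y1 Y2 r (bracket_xy ^ i * polarization d n i (\<A> i)) (in_y \<Psi>))) =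
      Const (evectant_coeff d n n' r s i) * transvectant (d + n - 2 * i) n' (r + s - i) (\<A> i) \<Psi>"
      using r s \<Psi> by (intro omega_of_transvection)
  qed
  finally show ?thesis .
qed

lemma omega_of_Gamma_form:
  assumes \<C>: "are_evectants d m n \<Theta> \<C>" and s: "s \<le> min d n"
  shows "on_diagonal ((Omega ^^ s) (Gamma_form d m \<Theta>)) = Const (mu_coef (d - s) (n - s) s s) * \<C> s"
proof -
  have "on_diagonal ((Omega ^^ s) (Gamma_form d m \<Theta>)) =
      (\<Sum>i\<le>min d n. on_diagonal ((Omega ^^ s) (bracket_xy ^ i * polarization d n i (\<C> i))))"
    using \<C> by (simp only: are_evectants_def Omega_funpow_sum on_diagonal_sum)
  also have "\<dots> = (\<Sum>i\<le>min d n.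
      Const (if i = s then mu_coef (d - s) (n - s) s s else 0) * \<C> i)"
  proof (intro sum.cong refl omega_of_gordan_term s)
    fix i assume "i \<in> {..min d n}"
    then show "i \<le> min d n" by simp
    then show "is_form d (d + n - 2 * i) (\<C> i)"
      using \<C> by (simp add: are_evectants_def)
  qed
  also have "\<dots> = (\<Sum>i\<le>min d n. if i = s then Const (mu_coef (d - s) (n - s) s s) * \<C> s else 0)"
    by (intro sum.cong refl) simp
  also have "\<dots> = Const (mu_coef (d - s) (n - s) s s) * \<C> s"
    using s by (simp add: sum.delta)
  finally show ?thesis .
qed

text \<open>
  \<open>\<kappa>\<close> combines the normalizing factor of \<open>(\<Phi>, \<Psi>)\<^sub>r\<close>, the factor \<open>1/(m + m')\<close> of \<open>\<Gamma>\<^sub>\<Theta>\<close>, and the inverse of the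
  constant with which the selection of the \<open>s\<close>-th term multiplies \<open>\<C>\<^sub>s\<close>.
\<close>

lemma kappa_coef_eq:
  assumes r: "r \<le> min n n'" and s: "s \<le> min d (n + n' - 2 * r)"
  shows "kappa_coef d m n m' n' r s * mu_coef (d - s) (n + n' - 2 * r - s) s s =
    fact (n - r) * fact (n' - r) / (fact n * fact n') * (1 / of_nat (m + m'))"
proof -
  have e: "d - s + (n + n' - 2 * r - s) + 2 * s + 1 - s = d + n + n' + 1 - 2 * r - s"
    "d - s + (n + n' - 2 * r - s) + s + 1 - s = d + n + n' + 1 - 2 * r - 2 * s"
    using r s by auto
  have "a * b * p / (e * f * c * q * M) * (c / 1 * (q / p)) = a * b / (e * f) * (1 / M)"
    if "c \<noteq> 0" "p \<noteq> 0" "q \<noteq> 0" for a b p e f c q M :: complex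
    using that by (simp add: field_simps)
  from this [of "fact s" "fact (d + n + n' + 1 - 2 * r - 2 * s)" "fact (d + n + n' + 1 - 2 * r - s)"
    "fact (n - r)" "fact (n' - r)" "fact n" "fact n'" "of_nat (m + m')"]
  show ?thesis
    by (simp only: kappa_coef_def mu_coef_def e diff_self_eq_0 fact_0 fact_nonzero not_False_eq_True
        simp_thms)
qed

theorem theorem5p4:
  fixes d m n m' n' r s :: nat
    and \<Phi> \<Psi> \<Theta> :: mpol
    and \<A> \<B> \<C> :: "nat \<Rightarrow> mpol"
  assumes "m \<ge> 1" and "m' \<ge> 1"
    and "is_covariant d m n \<Phi>"
    and "is_covariant d m' n' \<Psi>"
    and "are_evectants d m n \<Phi> \<A>"
    and "are_evectants d m' n' \<Psi> \<B>"
    and "r \<le> min n n'"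
    and "\<Theta> = transvectant n n' r \<Phi> \<Psi>"
    and "are_evectants d (m + m') (n + n' - 2 * r) \<Theta> \<C>"
    and "s \<le> min d (n + n' - 2 * r)"
  shows "\<C> s =
    (\<Sum>i\<le>min d n. Const (xi_coef d m n m' n' r s i) *
       transvectant (d + n - 2 * i) n' (r + s - i) (\<A> i) \<Psi>) +
    (\<Sum>i\<le>min d n'. Const (eta_coef d m n m' n' r s i) *
       transvectant (d + n' - 2 * i) n (r + s - i) (\<B> i) \<Phi>)"
proof -
  let ?\<mu> = "mu_coef (d - s) (n + n' - 2 * r - s) s s"
  let ?c = "fact (n - r) * fact (n' - r) / (fact n * fact n') :: complex"
  let ?\<kappa> = "kappa_coef d m n m' n' r s"
  let ?T = "transvection Y1 Y2 r (in_y \<Phi>) (in_y \<Psi>)"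
  let ?TA = "transvection Y1 Y2 r (evectant_operator d (in_y \<Phi>)) (in_y \<Psi>)"
  let ?TB = "transvection Y1 Y2 r (evectant_operator d (in_y \<Psi>)) (in_y \<Phi>)"
  let ?A = "\<Sum>i\<le>min d n. Const (evectant_coeff d n n' r s i) *
      transvectant (d + n - 2 * i) n' (r + s - i) (\<A> i) \<Psi>"
  let ?B = "\<Sum>i\<le>min d n'. Const (evectant_coeff d n' n r s i) *
      transvectant (d + n' - 2 * i) n (r + s - i) (\<B> i) \<Phi>"
  have \<Phi>: "is_form d n \<Phi>" and \<Psi>: "is_form d n' \<Psi>"
    using assms(3,4) by (simp_all add: is_covariant_def)
  have xi: "xi_coef d m n m' n' r s i = ?\<kappa> * of_nat m * evectant_coeff d n n' r s i" for i
    by (simp only: xi_coef_def evectant_coeff_def)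
  have eta: "eta_coef d m n m' n' r s i =
      (- 1) ^ r * ?\<kappa> * of_nat m' * evectant_coeff d n' n r s i" for i
    by (simp only: eta_coef_def evectant_coeff_def add.commute [of n' n])
  have \<mu>: "?\<mu> \<noteq> 0"
    unfolding mu_coef_def by (simp only: mult_eq_0_iff divide_eq_0_iff fact_nonzero simp_thms)
  have "in_y \<Theta> = Const ?c * ?T"
    unfolding assms(8) transvectant_eq [OF assms(7)]
      in_y_transvection [OF pdiff_Y_form [OF \<Phi>] pdiff_Y_form [OF \<Psi>], symmetric]
    by (simp add: in_y_eq substitute_mult)
  then have "Gamma_form d (m + m') \<Theta> =
      Const (1 / of_nat (m + m')) * evectant_operator d (Const ?c * ?T)"
    by (simp only: Gamma_form_def evectant_operator_def)
  also have "evectant_operator d (Const ?c * ?T) = Const ?c * evectant_operator d ?T"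
    unfolding evectant_operator_def sum_distrib_left pdiff_Const_mult
    by (intro sum.cong refl) (simp only: mult_ac)
  finally have "Gamma_form d (m + m') \<Theta> =
      Const (1 / of_nat (m + m')) * (Const ?c * (?TA + Const ((- 1) ^ r) * ?TB))"
    by (simp only: evectant_operator_transvection)
  then have "on_diagonal ((Omega ^^ s) (Gamma_form d (m + m') \<Theta>)) =
      Const (1 / of_nat (m + m')) * (Const ?c * (on_diagonal ((Omega ^^ s) ?TA) +
        Const ((- 1) ^ r) * on_diagonal ((Omega ^^ s) ?TB)))"
    by (simp only: Omega_funpow_Const_mult Omega_funpow_add on_diagonal_mult on_diagonal_add
        on_diagonal_Const)
  moreover have "on_diagonal ((Omega ^^ s) ?TA) = Const (of_nat m) * ?A"
    by (rule omega_of_transvection_evectants [OF assms(1,5) \<Psi> assms(7,10)])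
  moreover have "on_diagonal ((Omega ^^ s) ?TB) = Const (of_nat m') * ?B"
    using assms(7,10)
    by (intro omega_of_transvection_evectants [OF assms(2,6) \<Phi>]) (simp_all add: add.commute)
  moreover have "on_diagonal ((Omega ^^ s) (Gamma_form d (m + m') \<Theta>)) = Const ?\<mu> * \<C> s"
    by (rule omega_of_Gamma_form [OF assms(9,10)])
  ultimately have "Const ?\<mu> * \<C> s = Const (?c * (1 / of_nat (m + m'))) *
      (Const (of_nat m) * ?A + Const ((- 1) ^ r * of_nat m') * ?B)"
    by (simp only: Const_mult mult_ac)
  also have "?c * (1 / of_nat (m + m')) = ?\<mu> * ?\<kappa>"
    by (rule trans [OF kappa_coef_eq [OF assms(7,10), symmetric] mult.commute])
  finally have "Const (1 / ?\<mu>) * (Const ?\<mu> * \<C> s) = Const (1 / ?\<mu>) * (Const (?\<mu> * ?\<kappa>) *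
      (Const (of_nat m) * ?A + Const ((- 1) ^ r * of_nat m') * ?B))"
    by (simp only:)
  then have "\<C> s = Const ?\<kappa> * (Const (of_nat m) * ?A + Const ((- 1) ^ r * of_nat m') * ?B)"
    using \<mu> by (simp only: mult.assoc [symmetric] Const_mult [symmetric]) simp
  also have "\<dots> = Const (?\<kappa> * of_nat m) * ?A + Const ((- 1) ^ r * ?\<kappa> * of_nat m') * ?B"
    by (simp only: Const_mult distrib_left mult_ac)
  also have "Const (?\<kappa> * of_nat m) * ?A = (\<Sum>i\<le>min d n. Const (xi_coef d m n m' n' r s i) *
       transvectant (d + n - 2 * i) n' (r + s - i) (\<A> i) \<Psi>)"
    by (simp only: xi sum_distrib_left Const_mult mult.assoc)
  also have "Const ((- 1) ^ r * ?\<kappa> * of_nat m') * ?B =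
    (\<Sum>i\<le>min d n'. Const (eta_coef d m n m' n' r s i) *
       transvectant (d + n' - 2 * i) n (r + s - i) (\<B> i) \<Phi>)"
    by (simp only: eta sum_distrib_left Const_mult mult.assoc)
  finally show ?thesis .
qed

end
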